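(* Let $Q$ be the cube graph. The pot $$P_2=\big\{\{1,1,1\},\{2,2,2\},\{-2,-3,-3\},\{-1,-4,-4\},\{3,4,5\},\{-1,-2,-5\}\big\}$$ (inner braces denoting multisets) is a biminimal pot that $3$-realizes the cube; that is, $P_2$ $3$-realizes $Q$, $|P_2|=T_3(Q)$ and $|\Sigma(P_2)|=B_3(Q)$.
   Context: Graphs are connected, have non-empty vertex set, and may have loops and multiple edges. Formally a graph is a triple $(V(G),E(G),\mu)$ with $\mu$ assigning to each edge an unordered pair of (not necessarily distinct) vertices (undirected graph) or an ordered pair of vertices (directed graph). An orientation $\vec G$ of an undirected graph $G$ is a directed graph obtained by choosing a direction for every edge of $G$. The cube $Q$ is the simple undirected graph with vertex set $\mathbb{Z}_2^3$ in which $x,y$ are adjacent iff $x-y\in\{100,010,001\}$. An edge-coloring of a graph with $c$ colors is any map $\lambda$ from its edge set to $[1,c]=\{1,\dots,c\}$ (no properness required). A tile is a finite multiset of integers; a pot is a set of tiles. $\Sigma(P)$ is the set of positive integers (colors) appearing in some tile of the pot $P$. For an edge-coloring $\lambda$ of a directed graph $D$ and a vertex $x$, the tile $\tau_x(\lambda)$ is the multiset containing one copy of $\lambda(e)$ for each non-loop edge $e$ with tail $x$ (i.e. $e=(x,y)$, $y\ne x$), one copy of $-\lambda(e)$ for each non-loop edge $e$ with head $x$ (i.e. $e=(y,x)$, $y\neq x$), and both $\lambda(e)$ and $-\lambda(e)$ for each loop $e$ at $x$. The pot induced by $\lambda$ is $\mathcal{P}(\lambda)=\{\tau_x(\lambda)\mid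 x\in V(D)\}$ (a set of distinct tiles). A pot $P$ realizes an undirected graph $G$, written $G\in\mathcal{O}(P)$, if there is an edge-coloring $\lambda$ of some orientation of $G$ with $\mathcal{P}(\lambda)\subseteq P$. $P$ $3$-realizes $G$ if $G\in\mathcal{O}(P)$ and there is no $H\in\mathcal{O}(P)$ with $H\not\simeq G$ and $|V(H)|\le|V(G)|$. $T_3(G)=\min\{|P| : P \text{ is a pot that 3-realizes } G\}$ and $B_3(G)=\min\{|\Sigma(P)| : P \text{ is a pot that 3-realizes } G\}$ (two independent minima). A pot $P$ that $3$-realizes $G$ is biminimal if $|P|=T_3(G)$ and $|\Sigma(P)|=B_3(G)$. *)

theory Defs
  imports
    "HOL-Library.Multiset"
    "HOL-Library.Product_Plus"
    "HOL-Library.Uprod"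
    "HOL-Library.Z2"
    "Graph_Theory.Digraph"
begin

text \<open>Undirected graphs with loops and multiple edges. Directed graphs are those of
  \<^theory>\<open>Graph_Theory.Digraph\<close>.\<close>

record ('v, 'e) multigraph =
  vertices :: "'v set"
  edges :: "'e set"
  ends :: "'e \<Rightarrow> 'v uprod"

definition adjacency :: "('v, 'e) multigraph \<Rightarrow> ('v \<times> 'v) set" where
  "adjacency G = {(x, y). \<exists>e\<in>edges G. ends G e = Upair x y}"

text \<open>Finiteness is required because tiles are finite multisets and orders of graphs are
  compared with \<^const>\<open>card\<close>.\<close>

locale connected_multigraph =
  fixes G :: "('v, 'e) multigraph"
  assumes finite_vertices: "finite (vertices G)"
    and finite_edges: "finite (edges G)"
    and ends_in_vertices: "e \<in> edges G \<Longrightarrow> set_uprod (ends G e) \<subseteq> vertices G"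
    and nonempty: "vertices G \<noteq> {}"
    and connected: "x \<in> vertices G \<Longrightarrow> y \<in> vertices G \<Longrightarrow> (x, y) \<in> (adjacency G)\<^sup>*"

definition multigraph_iso ::
    "('v, 'e) multigraph \<Rightarrow> ('w, 'f) multigraph \<Rightarrow> bool" (infix "\<simeq>\<^sub>G" 50) where
  "G \<simeq>\<^sub>G H \<longleftrightarrow> (\<exists>f g. bij_betw f (vertices G) (vertices H) \<and> bij_betw g (edges G) (edges H) \<and>
     (\<forall>e\<in>edges G. ends H (g e) = map_uprod f (ends G e)))"

definition orientation :: "('v, 'e) pre_digraph \<Rightarrow> ('v, 'e) multigraph \<Rightarrow> bool" where
  "orientation D G \<longleftrightarrow> verts D = vertices G \<and> arcs D = edges G \<and>
     (\<forall>e\<in>edges G. ends G e = Upair (tail D e) (head D e))"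

definition cube :: "(bit \<times> bit \<times> bit, (bit \<times> bit \<times> bit) uprod) multigraph" where
  "cube = \<lparr>vertices = UNIV,
           edges = {Upair x y |x y. x - y \<in> {(1, 0, 0), (0, 1, 0), (0, 0, 1)}},
           ends = (\<lambda>e. e)\<rparr>"

type_synonym tile = "int multiset"
type_synonym pot = "tile set"

definition colors :: "pot \<Rightarrow> nat set" where
  "colors P = {c. c > 0 \<and> (\<exists>t\<in>P. int c \<in># t)}"

definition edge_coloring :: "('v, 'e) pre_digraph \<Rightarrow> nat \<Rightarrow> ('e \<Rightarrow> nat) \<Rightarrow> bool" where
  "edge_coloring D c col \<longleftrightarrow> (\<forall>e\<in>arcs D. col e \<in> {1..c})"

definition tile_at :: "('v, 'e) pre_digraph \<Rightarrow> ('e \<Rightarrow> nat) \<Rightarrow> 'v \<Rightarrow> tile" where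
  "tile_at D col x =
     {# int (col e). e \<in># mset_set {e \<in> arcs D. tail D e = x \<and> head D e \<noteq> x} #} +
     {# - int (col e). e \<in># mset_set {e \<in> arcs D. head D e = x \<and> tail D e \<noteq> x} #} +
     (\<Sum>e\<in>{e \<in> arcs D. tail D e = x \<and> head D e = x}. {# int (col e), - int (col e) #})"

definition induced_pot :: "('v, 'e) pre_digraph \<Rightarrow> ('e \<Rightarrow> nat) \<Rightarrow> pot" where
  "induced_pot D col = tile_at D col ` verts D"

definition realized :: "pot \<Rightarrow> ('v, 'e) multigraph set" ("\<O>") where
  "\<O> P = {G. connected_multigraph G \<and>
     (\<exists>D c col. orientation D G \<and> edge_coloring D c col \<and> induced_pot D col \<subseteq> P)}"

text \<open>Every finite graph has an isomorphic copy with natural numbers as vertices and edges, so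
  it suffices that the competitor \<open>H\<close> ranges over such graphs; the lemma \<open>three_realizes_iso\<close>
  below recovers the condition for \<open>H\<close> over arbitrary types.\<close>

definition three_realizes :: "pot \<Rightarrow> ('v, 'e) multigraph \<Rightarrow> bool" where
  "three_realizes P G \<longleftrightarrow> G \<in> \<O> P \<and>
     \<not> (\<exists>H :: (nat, nat) multigraph. H \<in> \<O> P \<and> \<not> H \<simeq>\<^sub>G G \<and> card (vertices H) \<le> card (vertices G))"

text \<open>The finiteness conditions below only discard infinite cardinalities, which \<^const>\<open>card\<close>
  would count as 0.\<close>

definition T\<^sub>3 :: "('v, 'e) multigraph \<Rightarrow> nat" where
  "T\<^sub>3 G = (LEAST n. \<exists>P. three_realizes P G \<and> finite P \<and> n = card P)"

definition B\<^sub>3 :: "('v, 'e) multigraph \<Rightarrow> nat" where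
  "B\<^sub>3 G = (LEAST n. \<exists>P. three_realizes P G \<and> finite (colors P) \<and> n = card (colors P))"

definition biminimal :: "pot \<Rightarrow> ('v, 'e) multigraph \<Rightarrow> bool" where
  "biminimal P G \<longleftrightarrow> three_realizes P G \<and>
     finite P \<and> card P = T\<^sub>3 G \<and> finite (colors P) \<and> card (colors P) = B\<^sub>3 G"

lemma realized_nat_copy:
  fixes H :: "('v, 'e) multigraph"
  assumes "H \<in> \<O> P"
  obtains K :: "(nat, nat) multigraph"
  where "K \<in> \<O> P" "H \<simeq>\<^sub>G K" "card (vertices K) = card (vertices H)"
proof -
  from assms obtain D c col where H: "connected_multigraph H" and D: "orientation D H"
    and col: "edge_coloring D c col" and pot: "induced_pot D col \<subseteq> P"
    by (auto simp: realized_def)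
  interpret H: connected_multigraph H by (fact H)
  obtain f :: "'v \<Rightarrow> nat" where f: "inj_on f (vertices H)"
    using finite_imp_inj_to_nat_seg[OF H.finite_vertices] by blast
  obtain g :: "'e \<Rightarrow> nat" where g: "inj_on g (edges H)"
    using finite_imp_inj_to_nat_seg[OF H.finite_edges] by blast
  define g' where "g' = inv_into (edges H) g"
  have g'[simp]: "g' (g e) = e" if "e \<in> edges H" for e
    using that g by (simp add: g'_def)
  define K where "K = \<lparr>vertices = f ` vertices H, edges = g ` edges H,
                       ends = (\<lambda>e. map_uprod f (ends H (g' e)))\<rparr>"
  define D' where "D' = \<lparr>verts = f ` vertices H, arcs = g ` edges H,
                        tail = (\<lambda>e. f (tail D (g' e))), head = (\<lambda>e. f (head D (g' e)))\<rparr>"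
  have vD: "verts D = vertices H" and aD: "arcs D = edges H"
    and eD: "\<And>e. e \<in> edges H \<Longrightarrow> ends H e = Upair (tail D e) (head D e)"
    using D by (auto simp: orientation_def)
  have th: "tail D e \<in> vertices H" "head D e \<in> vertices H" if "e \<in> edges H" for e
    using H.ends_in_vertices[OF that] eD[OF that] by auto
  have iso: "H \<simeq>\<^sub>G K"
    unfolding multigraph_iso_def
    by (rule exI[of _ f], rule exI[of _ g])
       (use f g in \<open>auto simp: K_def bij_betw_def\<close>)
  have adj: "(f x, f y) \<in> (adjacency K)\<^sup>*" if "(x, y) \<in> (adjacency H)\<^sup>*" for x y
    using that
  proof (induction rule: rtrancl_induct)
    case (step y z)
    then obtain e where "e \<in> edges H" "ends H e = Upair y z"
      by (auto simp: adjacency_def)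
    then have "(f y, f z) \<in> adjacency K"
      by (auto simp: adjacency_def K_def intro!: bexI[of _ e])
    with step.IH show ?case by (rule rtrancl_into_rtrancl)
  qed simp
  have "connected_multigraph K"
  proof
    show "finite (vertices K)" "finite (edges K)" "vertices K \<noteq> {}"
      using H.finite_vertices H.finite_edges H.nonempty by (auto simp: K_def)
    show "set_uprod (ends K e) \<subseteq> vertices K" if "e \<in> edges K" for e
      using that H.ends_in_vertices by (fastforce simp: K_def uprod.set_map)
    show "(x, y) \<in> (adjacency K)\<^sup>*" if "x \<in> vertices K" "y \<in> vertices K" for x y
      using that H.connected adj by (auto simp: K_def)
  qed
  moreover have "orientation D' K"
    by (auto simp: orientation_def D'_def K_def eD)
  moreover have "edge_coloring D' c (col \<circ> g')"
    using col by (auto simp: edge_coloring_def D'_def aD)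
  moreover have "induced_pot D' (col \<circ> g') \<subseteq> P"
  proof -
    have "tile_at D' (col \<circ> g') (f x) = tile_at D col x" if x: "x \<in> vertices H" for x
    proof -
      have eqf: "f (tail D e) = f x \<longleftrightarrow> tail D e = x" "f (head D e) = f x \<longleftrightarrow> head D e = x"
          "f (tail D e) = f (head D e) \<longleftrightarrow> tail D e = head D e"
          "f (head D e) = f (tail D e) \<longleftrightarrow> head D e = tail D e"
        if "e \<in> edges H" for e
        using f x th[OF that] by (auto simp: inj_on_eq_iff)
      have sets:
        "{e \<in> arcs D'. tail D' e = f x \<and> head D' e \<noteq> f x}
           = g ` {e \<in> edges H. tail D e = x \<and> head D e \<noteq> x}"
        "{e \<in> arcs D'. head D' e = f x \<and> tail D' e \<noteq> f x}
           = g ` {e \<in> edges H. head D e = x \<and> tail D e \<noteq> x}"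
        "{e \<in> arcs D'. tail D' e = f x \<and> head D' e = f x}
           = g ` {e \<in> edges H. tail D e = x \<and> head D e = x}"
        by (auto simp: D'_def eqf)
      have inj: "inj_on g {e \<in> edges H. Q e}" for Q
        using g by (rule inj_on_subset) auto
      have im: "mset_set (g ` {e \<in> edges H. Q e}) = image_mset g (mset_set {e \<in> edges H. Q e})" for Q
        using image_mset_mset_set[OF inj] by simp
      have cong: "{# h (g' (g e)). e \<in># mset_set {e \<in> edges H. Q e} #}
          = {# h e. e \<in># mset_set {e \<in> edges H. Q e} #}" for h :: "'e \<Rightarrow> int" and Q
        using H.finite_edges by (intro image_mset_cong) auto
      show ?thesis
        unfolding tile_at_def sets im sum.reindex[OF inj] aD
        using cong[of "\<lambda>e. int (col e)"] cong[of "\<lambda>e. - int (col e)"]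
        by (auto simp: multiset.map_comp comp_def intro!: sum.cong)
    qed
    with pot show ?thesis
      by (auto simp: induced_pot_def vD) (auto simp: D'_def)
  qed
  ultimately have "K \<in> \<O> P"
    unfolding realized_def by blast
  moreover have "card (vertices K) = card (vertices H)"
    using f by (simp add: K_def card_image)
  ultimately show thesis using iso that by blast
qed

lemma multigraph_iso_trans:
  assumes "G \<simeq>\<^sub>G H" "H \<simeq>\<^sub>G K"
  shows "G \<simeq>\<^sub>G K"
proof -
  from assms obtain f g f' g' where
    "bij_betw f (vertices G) (vertices H)" "bij_betw g (edges G) (edges H)"
    "\<forall>e\<in>edges G. ends H (g e) = map_uprod f (ends G e)"
    "bij_betw f' (vertices H) (vertices K)" "bij_betw g' (edges H) (edges K)"
    "\<forall>e\<in>edges H. ends K (g' e) = map_uprod f' (ends H e)"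
    unfolding multigraph_iso_def by blast
  then show ?thesis
    unfolding multigraph_iso_def
    by (intro exI[of _ "f' \<circ> f"] exI[of _ "g' \<circ> g"])
       (auto intro: bij_betw_trans simp: bij_betw_apply uprod.map_comp)
qed

lemma three_realizes_iso:
  fixes H :: "('w, 'f) multigraph"
  assumes "three_realizes P G" "H \<in> \<O> P" "card (vertices H) \<le> card (vertices G)"
  shows "H \<simeq>\<^sub>G G"
proof -
  obtain K :: "(nat, nat) multigraph"
    where "K \<in> \<O> P" "H \<simeq>\<^sub>G K" "card (vertices K) = card (vertices H)"
    using realized_nat_copy[OF assms(2)] .
  with assms show ?thesis
    using multigraph_iso_trans unfolding three_realizes_def by metis
qed

end

(*
  If two arcs of an oriented cube have the same color, exchanging their heads keeps all tiles. If the
  pot 3-realizes the cube, the result must again be a cube, and this forces the two arcs to share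
  their tail, share their head, or be antipodal and oppositely directed. Hence equal tiles sit at
  distance 2, never three at a time, and two pairs of equal tiles on one side of the bipartition
  leave four different tiles on the other: at least six tiles occur. Also every color class has at
  most three edges, and one with three edges is the full star of a vertex. With at most four colors
  the 12 edges would split into such stars, and then the tiles at a vertex that is no centre and at
  its three neighbors build the smaller graph K_{3,3}.

  Conversely, counting the positive and negative occurrences of each color in the given pot shows
  that a graph on at most 8 vertices uses the six tiles 1, 1, 1, 1, 2, 2 times, and
  these eight vertices can be joined in only one way.
*)

theory Submission
  imports Defs
begin

section \<open>Competing graphs\<close>

text \<open>Forgets directions and keeps the arcs as edges. \<open>D\<close> is an orientation of it
  by construction, so competitors can be built as digraphs.\<close>

definition multigraph_of :: "('v, 'e) pre_digraph \<Rightarrow> ('v, 'e) multigraph" where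
  "multigraph_of D = \<lparr>vertices = verts D, edges = arcs D, ends = (\<lambda>e. Upair (tail D e) (head D e))\<rparr>"

lemma multigraph_of_simps [simp]:
  "vertices (multigraph_of D) = verts D"
  "edges (multigraph_of D) = arcs D"
  "ends (multigraph_of D) e = Upair (tail D e) (head D e)"
  by (simp_all add: multigraph_of_def)

lemma image_mset_mset_set_eq_sum:
  "finite A \<Longrightarrow> image_mset f (mset_set A) = (\<Sum>a\<in>A. {#f a#})"
  by (induction A rule: finite_induct) auto

text \<open>A loop at \<open>x\<close> is met once through its tail and once through its head, and
  these are exactly its two entries; so loops need no case of their own.\<close>

lemma tile_at_eq_sum:
  assumes "finite (arcs D)"
  shows "tile_at D col x =
    (\<Sum>e\<in>arcs D. if tail D e = x then {#int (col e)#} else {#}) +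
    (\<Sum>e\<in>arcs D. if head D e = x then {#- int (col e)#} else {#})"
proof -
  have "tile_at D col x =
    (\<Sum>e\<in>arcs D. if tail D e = x \<and> head D e \<noteq> x then {#int (col e)#} else {#}) +
    (\<Sum>e\<in>arcs D. if head D e = x \<and> tail D e \<noteq> x then {#- int (col e)#} else {#}) +
    (\<Sum>e\<in>arcs D. if tail D e = x \<and> head D e = x then {#int (col e), - int (col e)#} else {#})"
    using assms by (simp add: tile_at_def image_mset_mset_set_eq_sum sum.inter_filter)
  also have "\<dots> = (\<Sum>e\<in>arcs D. (if tail D e = x then {#int (col e)#} else {#}) +
     (if head D e = x then {#- int (col e)#} else {#}))"
    unfolding sum.distrib[symmetric] by (intro sum.cong) auto
  finally show ?thesis
    by (simp add: sum.distrib)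
qed

text \<open>Colors are positive, so positive entries stem from tails only and negative ones from
  heads only.\<close>

lemma count_tile_at:
  assumes "finite (arcs D)" "n > 0" "edge_coloring D c col"
  shows "count (tile_at D col x) (int n) = card {e \<in> arcs D. tail D e = x \<and> col e = n}"
    and "count (tile_at D col x) (- int n) = card {e \<in> arcs D. head D e = x \<and> col e = n}"
proof -
  have pos: "col e > 0" if "e \<in> arcs D" for e
    using assms(3) that by (auto simp: edge_coloring_def)
  have "count (tile_at D col x) (int n) = (\<Sum>e\<in>arcs D. if tail D e = x \<and> col e = n then 1 else 0)"
    unfolding tile_at_eq_sum[OF assms(1)] count_union count_sum sum.distrib[symmetric]
    using assms(2) by (intro sum.cong) auto
  then show "count (tile_at D col x) (int n) = card {e \<in> arcs D. tail D e = x \<and> col e = n}"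
    using assms(1) by (simp add: sum.inter_filter[symmetric])
  have "count (tile_at D col x) (- int n) = (\<Sum>e\<in>arcs D. if head D e = x \<and> col e = n then 1 else 0)"
    unfolding tile_at_eq_sum[OF assms(1)] count_union count_sum sum.distrib[symmetric]
    using assms(2) pos by (intro sum.cong) auto
  then show "count (tile_at D col x) (- int n) = card {e \<in> arcs D. head D e = x \<and> col e = n}"
    using assms(1) by (simp add: sum.inter_filter[symmetric])
qed

text \<open>Rewiring that cannot be seen in the pot: reindexing the sum over heads by
  \<open>p\<close> shows that each vertex keeps its negative entries, and the tails are
  untouched.\<close>

lemma tile_at_permute_heads:
  assumes "finite (arcs D)" "bij_betw p (arcs D) (arcs D)" "\<And>e. e \<in> arcs D \<Longrightarrow> col (p e) = col e"
  shows "tile_at (D\<lparr>head := head D \<circ> p\<rparr>) col x = tile_at D col x"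
proof -
  have "(\<Sum>e\<in>arcs D. if head D (p e) = x then {#- int (col e)#} else {#})
      = (\<Sum>e\<in>arcs D. if head D (p e) = x then {#- int (col (p e))#} else {#})"
    using assms(3) by (intro sum.cong) auto
  also have "\<dots> = (\<Sum>e\<in>arcs D. if head D e = x then {#- int (col e)#} else {#})"
    using assms(2) by (rule sum.reindex_bij_betw)
  finally show ?thesis
    using assms(1) by (simp add: tile_at_eq_sum)
qed

lemma multigraph_iso_card:
  assumes "G \<simeq>\<^sub>G H"
  shows "card (vertices G) = card (vertices H)"
  using assms by (auto simp: multigraph_iso_def bij_betw_same_card)

text \<open>A component of \<open>D\<close> is a realized graph, and it is too small to be \<open>G\<close> unless it is all of \<open>D\<close>;
  so connectedness of \<open>D\<close> need not be assumed.\<close>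

lemma three_realizes_competitor:
  assumes "three_realizes P G" and "fin_digraph D" and "verts D \<noteq> {}"
    and "card (verts D) \<le> card (vertices G)"
    and "edge_coloring D c col" and "induced_pot D col \<subseteq> P"
  shows "multigraph_of D \<simeq>\<^sub>G G"
proof -
  interpret fin_digraph D by fact
  obtain r where r: "r \<in> verts D" using assms(3) by blast
  let ?R = "(adjacency (multigraph_of D))\<^sup>*"
  define C where "C = {y \<in> verts D. (r, y) \<in> ?R}"
  define D' where "D' = D\<lparr>verts := C, arcs := {e \<in> arcs D. tail D e \<in> C}\<rparr>"
  have D'_simps [simp]: "verts D' = C" "arcs D' = {e \<in> arcs D. tail D e \<in> C}"
      "tail D' = tail D" "head D' = head D"
    by (simp_all add: D'_def)
  have adjI: "(tail D e, head D e) \<in> ?R" "(head D e, tail D e) \<in> ?R" if "e \<in> arcs D" for e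
    using that by (auto simp: adjacency_def intro!: r_into_rtrancl)
  have CI: "tail D e \<in> C \<longleftrightarrow> head D e \<in> C" if "e \<in> arcs D" for e
    using adjI[OF that] that by (auto simp: C_def intro: rtrancl_trans)
  have path: "(r, y) \<in> (adjacency (multigraph_of D'))\<^sup>* \<and> y \<in> C" if "(r, y) \<in> ?R" for y
    using that
  proof (induction rule: rtrancl_induct)
    case base
    then show ?case using r by (simp add: C_def)
  next
    case (step y z)
    then obtain e where e: "e \<in> arcs D" "Upair (tail D e) (head D e) = Upair y z"
      by (auto simp: adjacency_def)
    with step.IH CI[of e] have "z \<in> C" "(y, z) \<in> adjacency (multigraph_of D')"
      by (auto simp: adjacency_def intro!: exI[of _ e])
    with step.IH show ?case by (auto intro: rtrancl_into_rtrancl)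
  qed
  have sym': "sym ((adjacency (multigraph_of D'))\<^sup>*)"
    by (rule sym_rtrancl) (auto simp: sym_def adjacency_def)
  have conn: "connected_multigraph (multigraph_of D')"
  proof
    show "finite (vertices (multigraph_of D'))" "finite (edges (multigraph_of D'))"
      by (simp_all add: C_def)
    show "vertices (multigraph_of D') \<noteq> {}"
      using r by (auto simp: C_def)
    show "set_uprod (ends (multigraph_of D') e) \<subseteq> vertices (multigraph_of D')"
      if "e \<in> edges (multigraph_of D')" for e
      using that CI[of e] by auto
    show "(x, y) \<in> (adjacency (multigraph_of D'))\<^sup>*"
      if "x \<in> vertices (multigraph_of D')" "y \<in> vertices (multigraph_of D')" for x y
    proof -
      have "(r, x) \<in> (adjacency (multigraph_of D'))\<^sup>*" "(r, y) \<in> (adjacency (multigraph_of D'))\<^sup>*"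
        using that path by (auto simp: C_def)
      then show ?thesis
        using sym' by (meson rtrancl_trans symD)
    qed
  qed
  \<comment> \<open>No arc at a vertex of \<open>C\<close> was dropped: by \<open>CI\<close>, an arc
    whose head lies in \<open>C\<close> also has its tail there.\<close>
  have "tile_at D' col x = tile_at D col x" if "x \<in> C" for x
  proof -
    have "{e \<in> arcs D'. tail D' e = x \<and> Q e} = {e \<in> arcs D. tail D e = x \<and> Q e}" for Q
      using that by auto
    moreover have "{e \<in> arcs D'. head D' e = x \<and> Q e} = {e \<in> arcs D. head D e = x \<and> Q e}" for Q
      using that CI by auto
    ultimately show ?thesis by (simp only: tile_at_def D'_simps(3,4))
  qed
  then have "induced_pot D' col \<subseteq> P"
    using assms(6) by (auto simp: induced_pot_def C_def)
  moreover have "edge_coloring D' c col"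
    using assms(5) by (simp add: edge_coloring_def)
  moreover have "orientation D' (multigraph_of D')"
    by (simp add: orientation_def)
  ultimately have "multigraph_of D' \<in> \<O> P"
    using conn unfolding realized_def by blast
  moreover have "C \<subseteq> verts D"
    by (auto simp: C_def)
  then have "card C \<le> card (verts D)"
    by (rule card_mono[rotated]) simp
  ultimately have iso: "multigraph_of D' \<simeq>\<^sub>G G"
    using assms(4) by (intro three_realizes_iso[OF assms(1)]) auto
  from multigraph_iso_card[OF this] have "card C = card (vertices G)" by simp
  with assms(4) \<open>C \<subseteq> verts D\<close> have "C = verts D"
    using card_seteq[of "verts D" C] by simp
  then have "D' = D"
    by (simp add: D'_def cong: conj_cong)
  with iso show ?thesis by simp
qed

section \<open>The cube\<close>

type_synonym cube_vertex = "bit \<times> bit \<times> bit"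

definition parity :: "cube_vertex \<Rightarrow> bit" where
  "parity = (\<lambda>(a, b, c). a + b + c)"

definition antipode :: "cube_vertex \<Rightarrow> cube_vertex" where
  "antipode = (\<lambda>(a, b, c). (1 + a, 1 + b, 1 + c))"

text \<open>The cube is the complete bipartite graph \<open>K\<^sub>4\<^sub>,\<^sub>4\<close> minus the perfect matching that joins
  antipodal vertices.\<close>

definition adjacent :: "cube_vertex \<Rightarrow> cube_vertex \<Rightarrow> bool" where
  "adjacent x y \<longleftrightarrow> parity x \<noteq> parity y \<and> y \<noteq> antipode x"

lemma all_bit: "(\<forall>a::bit. Q a) \<longleftrightarrow> Q 0 \<and> Q 1"
  by (metis bit.exhaust)

lemma UNIV_cube_vertex: "(UNIV :: cube_vertex set) = 
  {(0,0,0), (0,0,1), (0,1,0), (0,1,1), (1,0,0), (1,0,1), (1,1,0), (1,1,1)}"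
  by (auto simp: set_eq_iff all_bit)

lemma finite_cube_vertex [simp]: "finite (A :: cube_vertex set)"
  by (rule finite_subset[OF subset_UNIV]) (simp add: UNIV_cube_vertex)

lemma card_cube_vertices: "card (vertices cube) = 8"
  by (simp add: cube_def UNIV_cube_vertex)

lemma vertices_cube [simp]: "vertices cube = UNIV" and ends_cube [simp]: "ends cube e = e"
  by (simp_all add: cube_def)

text \<open>A check over all bit values. It replaces the coordinate description of edges by parity
  and antipodes.\<close>

lemma difference_unit_iff_adjacent:
  "x - y \<in> {(1, 0, 0), (0, 1, 0), (0, 0, 1)} \<longleftrightarrow> adjacent x y"
proof -
  have "\<forall>a b c a' b' c' :: bit. (a, b, c) - (a', b', c') \<in> {(1, 0, 0), (0, 1, 0), (0, 0, 1)}
      \<longleftrightarrow> adjacent (a, b, c) (a', b', c')"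
    unfolding all_bit by (simp add: adjacent_def parity_def antipode_def zero_prod_def)
  then show ?thesis by (cases x; cases y) blast
qed

lemma antipode_antipode [simp]: "antipode (antipode x) = x"
  by (cases x) (simp add: antipode_def add.assoc[symmetric])

lemma antipode_inject [simp]: "antipode x = antipode y \<longleftrightarrow> x = y"
  by (metis antipode_antipode)

lemma parity_antipode: "parity (antipode x) \<noteq> parity x"
  by (cases x; cases "fst x"; cases "fst (snd x)"; cases "snd (snd x)") (auto simp: antipode_def parity_def)

lemma adjacent_sym: "adjacent x y \<longleftrightarrow> adjacent y x"
  by (auto simp: adjacent_def)

lemma Upair_commute: "Upair x y = Upair y x"
  by simp

lemma edges_cube: "edges cube = {Upair x y |x y. adjacent x y}"
  unfolding cube_def difference_unit_iff_adjacent by simp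

lemma Upair_in_edges_cube: "Upair x y \<in> edges cube \<longleftrightarrow> adjacent x y"
  using adjacent_sym unfolding edges_cube by fastforce

lemma finite_edges_cube: "finite (edges cube)"
proof -
  have "edges cube \<subseteq> (\<lambda>(x, y). Upair x y) ` UNIV"
    by (auto simp: edges_cube)
  then show ?thesis
    by (rule finite_subset) (simp add: finite_Prod_UNIV)
qed

lemma parity_class:
  obtains x y z w where "{v. parity v = p} = {x, y, z, w}" "distinct [x, y, z, w]"
proof -
  have "{v. parity v = 0} = {(0,0,0), (0,1,1), (1,0,1), (1,1,0)}"
    "{v. parity v = 1} = {(0,0,1), (0,1,0), (1,0,0), (1,1,1)}"
    by (auto simp: set_eq_iff all_bit parity_def)
  then show thesis
    by (cases p) (rule that, simp, simp)+
qed

lemma card_parity_class: "card {v. parity v = p} = 4"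
proof -
  obtain x y z w where "{v. parity v = p} = {x, y, z, w}" "distinct [x, y, z, w]"
    by (rule parity_class)
  then show ?thesis by simp
qed

lemma two_more_of_same_parity:
  assumes "parity x = parity v" "x \<noteq> v"
  obtains r t where "parity r = parity x" "parity t = parity x" "distinct [x, v, r, t]"
proof -
  obtain a b d e where E: "{z. parity z = parity x} = {a, b, d, e}" "distinct [a, b, d, e]"
    by (rule parity_class)
  then have "card ({z. parity z = parity x} - {x, v}) = 2"
    using assms by (subst card_Diff_subset) auto
  then obtain r t where "{z. parity z = parity x} - {x, v} = {r, t}" "r \<noteq> t"
    by (auto simp: card_2_iff)
  then show thesis
    using assms by (intro that[of r t]) auto
qed

text \<open>If the parities agreed, an edge from \<open>x\<close> to \<open>v\<close> would lie on a cycle of length 3 or 5.\<close>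

lemma two_coloring_of_cube_minus_two_edges:
  fixes \<chi> :: "cube_vertex \<Rightarrow> bit"
  assumes "adjacent x y" "adjacent u v" "x \<noteq> u" "y \<noteq> v"
    and edge: "\<And>a b. adjacent a b \<Longrightarrow> Upair a b \<noteq> Upair x y \<Longrightarrow> Upair a b \<noteq> Upair u v \<Longrightarrow> \<chi> a \<noteq> \<chi> b"
    and "\<chi> x \<noteq> \<chi> v"
  shows "parity x \<noteq> parity v"
proof
  assume par: "parity x = parity v"
  have "x \<noteq> v" using assms by auto
  with par obtain r t where rt: "parity r = parity x" "parity t = parity x" "distinct [x, v, r, t]"
    by (rule two_more_of_same_parity)
  have ne: "parity y \<noteq> parity x" "parity u \<noteq> parity x" "y \<noteq> antipode x" "u \<noteq> antipode v"
    using assms(1,2) par by (auto simp: adjacent_def)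
  have pa: "parity (antipode z) \<noteq> parity x" if "parity z = parity x" for z
    using parity_antipode[of z] that by simp
  have x: "\<chi> x \<noteq> \<chi> (antipode z)" if "z \<in> {v, r, t}" "y \<noteq> antipode z" for z
    using that rt par ne pa[of z] parity_antipode[of x] by (intro edge) (auto simp: adjacent_def)
  have v: "\<chi> v \<noteq> \<chi> (antipode z)" if "z \<in> {x, r, t}" "u \<noteq> antipode z" for z
    using that rt par ne pa[of z] parity_antipode[of v] by (intro edge) (auto simp: adjacent_def)
  have r: "\<chi> r \<noteq> \<chi> (antipode z)" if "z \<in> {x, v}" for z
    using that rt par ne pa[of z] parity_antipode[of r] by (intro edge) (auto simp: adjacent_def)
  show False
  proof (cases "y = antipode v \<or> u = antipode x")
    case True
    \<comment> \<open>\<open>y\<close> and \<open>u\<close> together exclude at most one of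
      \<open>r\<close> and \<open>t\<close>. For the other one, \<open>antipode z\<close> is joined
      to \<open>x\<close> and to \<open>v\<close> by remaining edges, and an edge from
      \<open>x\<close> to \<open>v\<close> would close a triangle.\<close>
    then have "y \<noteq> antipode r \<and> u \<noteq> antipode r \<or> y \<noteq> antipode t \<and> u \<noteq> antipode t"
      using rt by (metis antipode_inject distinct_length_2_or_more)
    then obtain z where "z \<in> {r, t}" "y \<noteq> antipode z" "u \<noteq> antipode z"
      by blast
    then have "\<chi> x \<noteq> \<chi> (antipode z)" "\<chi> v \<noteq> \<chi> (antipode z)"
      using x v by auto
    then show False
      using \<open>\<chi> x \<noteq> \<chi> v\<close> by (cases "\<chi> x"; cases "\<chi> v"; simp)
  next
    case False
    \<comment> \<open>The remaining edges contain the path \<open>x\<close>,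
      \<open>antipode v\<close>, \<open>r\<close>, \<open>antipode x\<close>, \<open>v\<close>,
      which an edge from \<open>x\<close> to \<open>v\<close> would close to a 5-cycle.\<close>
    then have "\<chi> x \<noteq> \<chi> (antipode v)" "\<chi> v \<noteq> \<chi> (antipode x)"
      "\<chi> r \<noteq> \<chi> (antipode x)" "\<chi> r \<noteq> \<chi> (antipode v)"
      using x v r by auto
    then show False
      using \<open>\<chi> x \<noteq> \<chi> v\<close> by (cases "\<chi> x"; cases "\<chi> v"; cases "\<chi> r"; simp)
  qed
qed

definition neighbors :: "cube_vertex \<Rightarrow> cube_vertex set" where
  "neighbors x = {a. adjacent x a}"

lemma neighbors_eq: "neighbors (p, q, r) = {(1 + p, q, r), (p, 1 + q, r), (p, q, 1 + r)}"
proof -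
  have "\<forall>p q r a b c. adjacent (p, q, r) (a, b, c) \<longleftrightarrow>
      (a, b, c) \<in> {(1 + p, q, r), (p, 1 + q, r), (p, q, 1 + r)}"
    unfolding all_bit by (simp add: adjacent_def parity_def antipode_def)
  then show ?thesis by (auto simp only: neighbors_def)
qed

lemma neighbors_distinct:
  obtains a b d where "neighbors x = {a, b, d}" "distinct [a, b, d]"
proof (cases x)
  case (fields p q r)
  show thesis
  proof (rule that)
    show "neighbors x = {(1 + p, q, r), (p, 1 + q, r), (p, q, 1 + r)}"
      by (simp add: fields neighbors_eq)
    show "distinct [(1 + p, q, r), (p, 1 + q, r), (p, q, 1 + r)]"
      by simp
  qed
qed

lemma card_neighbors: "card (neighbors x) = 3"
proof -
  obtain a b d where "neighbors x = {a, b, d}" "distinct [a, b, d]"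
    by (rule neighbors_distinct)
  then show ?thesis by simp
qed

text \<open>Each edge is counted at its even end: 4 even vertices with 3 neighbors each.\<close>

lemma card_edges_cube: "card (edges cube) = 12"
proof -
  let ?S = "Sigma {z. parity z = 0} neighbors"
  have "bij_betw (\<lambda>(x, a). Upair x a) ?S (edges cube)"
    unfolding bij_betw_def
  proof
    show "inj_on (\<lambda>(x, a). Upair x a) ?S"
      by (auto simp: inj_on_def neighbors_def adjacent_def)
    show "(\<lambda>(x, a). Upair x a) ` ?S = edges cube"
    proof (intro equalityI subsetI)
      fix e assume "e \<in> edges cube"
      then obtain x y where e: "e = Upair x y" "adjacent x y"
        unfolding edges_cube by blast
      show "e \<in> (\<lambda>(x, a). Upair x a) ` ?S"
      proof (cases "parity x = 0")
        case True
        then show ?thesis using e by (auto simp: neighbors_def intro!: rev_image_eqI[of "(x, y)"])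
      next
        case False
        then have "parity y = 0" using e(2) by (cases "parity y") (auto simp: adjacent_def)
        then show ?thesis using e adjacent_sym[of x y]
          by (auto simp: neighbors_def intro!: rev_image_eqI[of "(y, x)"])
      qed
    qed (auto simp: neighbors_def Upair_in_edges_cube)
  qed
  then have "card (edges cube) = card ?S"
    by (simp add: bij_betw_same_card)
  also have "\<dots> = 12"
    by (simp add: card_neighbors card_parity_class)
  finally show ?thesis .
qed

section \<open>Signed labels and tiles of an oriented, colored cube\<close>

locale oriented_cube =
  fixes D :: "(cube_vertex, cube_vertex uprod) pre_digraph"
    and c :: nat and col :: "cube_vertex uprod \<Rightarrow> nat"
  assumes orientation: "orientation D cube"
    and coloring: "edge_coloring D c col"
begin

lemma verts_D [simp]: "verts D = UNIV" and arcs_D: "arcs D = edges cube"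
  using orientation by (simp_all add: orientation_def)

lemma finite_arcs [simp]: "finite (arcs D)"
  by (simp add: arcs_D finite_edges_cube)

lemma arc_eq: "e \<in> arcs D \<Longrightarrow> Upair (tail D e) (head D e) = e"
  using orientation by (simp add: orientation_def)

lemma adjacent_arc: "e \<in> arcs D \<Longrightarrow> adjacent (tail D e) (head D e)"
  by (metis Upair_in_edges_cube arcs_D arc_eq)

text \<open>The signed color with which the edge from \<open>x\<close> to \<open>a\<close> contributes to the tile at \<open>x\<close>.\<close>

definition label :: "cube_vertex \<Rightarrow> cube_vertex \<Rightarrow> int" where
  "label x a = (if tail D (Upair x a) = x then int (col (Upair x a)) else - int (col (Upair x a)))"

lemma edge_arc:
  assumes "adjacent x a"
  shows "Upair x a \<in> arcs D"
    and "tail D (Upair x a) = x \<and> head D (Upair x a) = a \<and> label x a = int (col (Upair x a)) \<or>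
      tail D (Upair x a) = a \<and> head D (Upair x a) = x \<and> label x a = - int (col (Upair x a))"
proof -
  show "Upair x a \<in> arcs D" using assms by (simp add: arcs_D Upair_in_edges_cube)
  from arc_eq[OF this] show "tail D (Upair x a) = x \<and> head D (Upair x a) = a \<and> label x a = int (col (Upair x a)) \<or>
      tail D (Upair x a) = a \<and> head D (Upair x a) = x \<and> label x a = - int (col (Upair x a))"
    using assms by (auto simp: label_def adjacent_def)
qed

lemma color_pos: "e \<in> arcs D \<Longrightarrow> col e > 0"
  using coloring by (auto simp: edge_coloring_def)

lemma label_arc:
  assumes "e \<in> arcs D"
  shows "label (tail D e) (head D e) = int (col e)" "label (head D e) (tail D e) = - int (col e)"
proof -
  have "Upair (head D e) (tail D e) = e" "tail D e \<noteq> head D e"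
    using arc_eq[OF assms] adjacent_arc[OF assms] Upair_commute by (metis, auto simp: adjacent_def)
  then show "label (tail D e) (head D e) = int (col e)" "label (head D e) (tail D e) = - int (col e)"
    using arc_eq[OF assms] by (simp_all add: label_def)
qed

lemma label_flip: "adjacent x a \<Longrightarrow> label a x = - label x a"
  using edge_arc[of x a] label_arc[of "Upair x a"] by auto

lemma label_nonzero: "adjacent x a \<Longrightarrow> label x a \<noteq> 0"
  using edge_arc[of x a] color_pos[of "Upair x a"] by auto

lemma label_abs: "adjacent x a \<Longrightarrow> \<bar>label x a\<bar> = int (col (Upair x a))"
  using edge_arc(2)[of x a] by auto

text \<open>The cube is simple and loopless, so the arcs at \<open>x\<close> correspond to its
  neighbors, and the sign in \<open>label\<close> records whether \<open>x\<close> is tail or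
  head.\<close>

lemma tile_at_cube: "tile_at D col x = (\<Sum>a\<in>neighbors x. {#label x a#})"
proof -
  let ?g = "\<lambda>e. (if tail D e = x then {#int (col e)#} else {#}) +
    (if head D e = x then {#- int (col e)#} else {#})"
  have "tile_at D col x = (\<Sum>e\<in>arcs D. ?g e)"
    by (simp add: tile_at_eq_sum sum.distrib)
  also have "\<dots> = (\<Sum>e\<in>Upair x ` neighbors x. ?g e)"
  proof (rule sum.mono_neutral_right)
    show "Upair x ` neighbors x \<subseteq> arcs D"
      by (auto simp: neighbors_def edge_arc(1))
    show "\<forall>e\<in>arcs D - Upair x ` neighbors x. ?g e = {#}"
    proof
      fix e assume e: "e \<in> arcs D - Upair x ` neighbors x"
      have "e = Upair (tail D e) (head D e)" "e = Upair (head D e) (tail D e)"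
        using arc_eq[of e] e Upair_commute by (metis DiffD1)+
      moreover have "head D e \<in> neighbors (tail D e)" "tail D e \<in> neighbors (head D e)"
        using e adjacent_arc[of e] adjacent_sym by (auto simp: neighbors_def)
      ultimately have "e \<in> Upair (tail D e) ` neighbors (tail D e)" "e \<in> Upair (head D e) ` neighbors (head D e)"
        by (auto intro: image_eqI)
      then have "tail D e \<noteq> x" "head D e \<noteq> x"
        using e by auto
      then show "?g e = {#}" by simp
    qed
  qed simp
  also have "\<dots> = (\<Sum>a\<in>neighbors x. ?g (Upair x a))"
    by (subst sum.reindex) (auto simp: inj_on_def)
  also have "\<dots> = (\<Sum>a\<in>neighbors x. {#label x a#})"
  proof (rule sum.cong)
    fix a assume "a \<in> neighbors x"
    then have "adjacent x a" by (simp add: neighbors_def)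
    moreover from this have "x \<noteq> a" by (auto simp: adjacent_def)
    ultimately show "?g (Upair x a) = {#label x a#}"
      using edge_arc(2)[of x a] by auto
  qed simp
  finally show ?thesis .
qed

lemma in_tile_at_cube: "t \<in># tile_at D col x \<longleftrightarrow> (\<exists>a. adjacent x a \<and> t = label x a)"
  unfolding tile_at_cube by (auto simp: neighbors_def set_mset_sum)

end

section \<open>Equally colored arcs\<close>

locale three_realizing_coloring = oriented_cube D c col
  for D :: "(cube_vertex, cube_vertex uprod) pre_digraph" and c col +
  fixes P :: pot
  assumes three_realizes: "three_realizes P cube"
    and pot: "induced_pot D col \<subseteq> P"
begin

text \<open>Write the arcs as x -> y and u -> v. If neither end is shared, exchanging heads gives x
  -> v and u -> y, and the result is a copy of the cube. Being bipartite, it puts x and v, and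
  likewise u and y, on opposite sides; having no parallel edges, it shows that neither pair was
  adjacent before. Opposite and non-adjacent means antipodal.\<close>

lemma equal_color_arcs:
  assumes e: "e1 \<in> arcs D" "e2 \<in> arcs D" and "col e1 = col e2"
  shows "tail D e1 = tail D e2 \<or> head D e1 = head D e2 \<or>
    head D e2 = antipode (tail D e1) \<and> head D e1 = antipode (tail D e2)"
proof (rule ccontr)
  assume not: "\<not> ?thesis"
  define p where "p e = (if e = e1 then e2 else if e = e2 then e1 else e)" for e
  let ?D = "D\<lparr>head := head D \<circ> p\<rparr>"
  have p_arcs: "p e \<in> arcs D" if "e \<in> arcs D" for e
    using e that by (auto simp: p_def)
  have "bij_betw p (arcs D) (arcs D)"
    by (rule bij_betw_byWitness[of _ p]) (use e in \<open>auto simp: p_def\<close>)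
  then have tiles: "tile_at ?D col x = tile_at D col x" for x
    by (rule tile_at_permute_heads[OF finite_arcs]) (use assms(3) in \<open>auto simp: p_def\<close>)
  have "multigraph_of ?D \<simeq>\<^sub>G cube"
  proof (rule three_realizes_competitor[OF three_realizes])
    show "fin_digraph ?D"
      by unfold_locales auto
    show "edge_coloring ?D c col"
      using coloring by (simp add: edge_coloring_def)
    show "induced_pot ?D col \<subseteq> P"
      using pot by (simp add: induced_pot_def tiles)
  qed auto
  then obtain f g where g: "bij_betw g (arcs D) (edges cube)"
    and "\<And>e. e \<in> arcs D \<Longrightarrow> g e = Upair (f (tail D e)) (f (head D (p e)))"
    by (auto simp: multigraph_iso_def)
  \<comment> \<open>Edges of the cube are determined by their ends, so injectivity of
    \<open>g\<close> says that the rewired graph has no parallel edges.\<close>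
  then have inj: "e = e'" if "e \<in> arcs D" "e' \<in> arcs D"
    "Upair (tail D e) (head D (p e)) = Upair (tail D e') (head D (p e'))" for e e'
    using that by (auto dest!: bij_betw_imp_inj_on simp: inj_on_def)
  \<comment> \<open>Parity pulled back along \<open>f\<close> is a proper 2-coloring of the rewired
    graph.\<close>
  have \<chi>: "parity (f (tail D e)) \<noteq> parity (f (head D (p e)))" if "e \<in> arcs D" for e
    using that g \<open>e \<in> arcs D \<Longrightarrow> g e = _\<close> bij_betwE[OF g]
    by (metis Upair_in_edges_cube adjacent_def)
  let ?x = "tail D e1" and ?y = "head D e1" and ?u = "tail D e2" and ?v = "head D e2"
  have ne: "?x \<noteq> ?u" "?y \<noteq> ?v" using not by auto
  then have "e1 \<noteq> e2" by auto
  then have p [simp]: "p e1 = e2" "p e2 = e1" by (auto simp: p_def)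
  have adj: "adjacent ?x ?y" "adjacent ?u ?v" using e adjacent_arc by auto
  have col1: "parity (f ?x) \<noteq> parity (f ?v)" and col2: "parity (f ?u) \<noteq> parity (f ?y)"
    using \<chi>[of e1] \<chi>[of e2] e by auto
  have other: "parity (f a) \<noteq> parity (f b)"
    if "adjacent a b" "Upair a b \<noteq> e1" "Upair a b \<noteq> e2" for a b
  proof -
    have "Upair a b \<in> arcs D" "p (Upair a b) = Upair a b"
      using that by (auto simp: arcs_D Upair_in_edges_cube p_def)
    with \<chi>[of "Upair a b"] arc_eq[of "Upair a b"] show ?thesis
      by auto
  qed
  have "parity ?x \<noteq> parity ?v"
    by (rule two_coloring_of_cube_minus_two_edges[OF adj ne, where \<chi> = "\<lambda>z. parity (f z)"])
      (use other col1 e arc_eq in auto)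
  moreover have "parity ?u \<noteq> parity ?y"
    by (rule two_coloring_of_cube_minus_two_edges[OF adj(2,1), where \<chi> = "\<lambda>z. parity (f z)"])
      (use other col2 ne e arc_eq in auto)
  \<comment> \<open>If the new ends of \<open>d\<close> were adjacent in the cube, the old edge
    \<open>?a\<close> would survive the exchange and be parallel to the rewired
    \<open>d\<close>.\<close>
  moreover have "\<not> adjacent (tail D d) (head D (p d))" if d: "d = e1 \<or> d = e2" for d
  proof
    let ?a = "Upair (tail D d) (head D (p d))"
    assume "adjacent (tail D d) (head D (p d))"
    then have a: "?a \<in> arcs D" by (simp only: arcs_D Upair_in_edges_cube)
    have "?a \<noteq> Upair ?x ?y" "?a \<noteq> Upair ?u ?v"
      using d ne ne[symmetric] by auto
    then have a_ne: "?a \<noteq> e1" "?a \<noteq> e2"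
      by (simp_all only: arc_eq[OF e(1)] arc_eq[OF e(2)] not_False_eq_True)
    then have "Upair (tail D ?a) (head D (p ?a)) = ?a"
      using arc_eq[OF a] by (simp only: p_def if_False)
    with inj[OF a, of d] e d a_ne show False by blast
  qed
  from this[of e1] this[of e2] have "\<not> adjacent ?x ?v" "\<not> adjacent ?u ?y"
    by simp_all
  ultimately show False
    using not by (simp add: adjacent_def)
qed

text \<open>Equal labels mean equal color and equal direction, so \<open>x\<close> and
  \<open>u\<close> are both tails or both heads. The alternatives of \<open>equal_color_arcs\<close>
  are symmetric under reversing both arcs.\<close>

lemma equal_labels:
  assumes "adjacent x a" "adjacent u b" "label x a = label u b"
  shows "x = u \<or> a = b \<or> b = antipode x \<and> a = antipode u"
proof -
  have "col (Upair x a) = col (Upair u b)"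
    using label_abs[OF assms(1)] label_abs[OF assms(2)] assms(3) by simp
  with equal_color_arcs[OF edge_arc(1)[OF assms(1)] edge_arc(1)[OF assms(2)]]
  show ?thesis
    using edge_arc(2)[OF assms(1)] edge_arc(2)[OF assms(2)] assms(3)
      color_pos[OF edge_arc(1)[OF assms(1)]] by fastforce
qed

section \<open>At least six tiles\<close>

text \<open>Every label at \<open>x\<close> recurs at \<open>y\<close>. Since \<open>x\<close> and
  \<open>y\<close> differ, \<open>equal_labels\<close> lets it recur only on the edge to the same
  neighbor, or on the edge to \<open>antipode x\<close> if it came from the edge to
  \<open>antipode y\<close>. Either way \<open>x\<close> and \<open>y\<close> lie on the same
  side.\<close>

lemma equal_tiles:
  assumes "tile_at D col x = tile_at D col y" "x \<noteq> y"
  shows equal_tiles_parity: "parity x = parity y"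
    and equal_tiles_common_neighbor: "\<And>a. adjacent x a \<Longrightarrow> adjacent y a \<Longrightarrow> label x a = label y a"
    and equal_tiles_antipodes: "label x (antipode y) = label y (antipode x)"
proof -
  have ex: "\<exists>b. adjacent y b \<and> label x a = label y b \<and> (a = b \<or> b = antipode x \<and> a = antipode y)"
    if "adjacent x a" for a
    using in_tile_at_cube[of "label x a" x] in_tile_at_cube[of "label x a" y] that assms
      equal_labels[of x a y] by metis
  obtain a where a: "adjacent x a"
    using neighbors_distinct[of x] by (metis insertI1 mem_Collect_eq neighbors_def)
  show par: "parity x = parity y"
    using ex[OF a] a parity_antipode[of x] parity_antipode[of y] unfolding adjacent_def
    by (metis bit.exhaust)
  show "label x a = label y a" if "adjacent x a" "adjacent y a" for a
    using ex[OF that(1)] that by (auto simp: adjacent_def)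
  have "adjacent x (antipode y)"
    using par assms(2) parity_antipode[of y] by (auto simp: adjacent_def)
  from ex[OF this] show "label x (antipode y) = label y (antipode x)"
    by (auto simp: adjacent_def)
qed

lemma adjacent_antipode: "parity x = parity y \<Longrightarrow> x \<noteq> y \<Longrightarrow> adjacent x (antipode y)"
  using parity_antipode[of y] by (auto simp: adjacent_def)

text \<open>The label from \<open>x\<close> to \<open>antipode y\<close> is carried to the edge from
  \<open>y\<close> to \<open>antipode x\<close>, and from there to the edge from \<open>z\<close> to
  \<open>antipode x\<close>. The first and last edge are disjoint and not antipodal, against
  \<open>equal_labels\<close>.\<close>

lemma no_three_equal_tiles:
  assumes "distinct [x, y, z]"
    and "tile_at D col x = tile_at D col y" "tile_at D col x = tile_at D col z"
  shows False
proof -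
  have par: "parity y = parity x" "parity z = parity x"
    using assms equal_tiles_parity[of x y] equal_tiles_parity[of x z] by auto
  have "label x (antipode y) = label y (antipode x)"
    using assms equal_tiles_antipodes[of x y] by simp
  moreover have "label x (antipode y) = label z (antipode y)"
    using assms par by (intro equal_tiles_common_neighbor adjacent_antipode) auto
  moreover have "label y (antipode x) = label z (antipode x)"
    using assms par by (intro equal_tiles_common_neighbor adjacent_antipode) auto
  ultimately have "label x (antipode y) = label z (antipode x)"
    by simp
  moreover have "adjacent x (antipode y)" "adjacent z (antipode x)"
    using assms(1) par by (auto intro!: adjacent_antipode)
  ultimately show False
    using equal_labels[of x "antipode y" z "antipode x"] assms(1) by auto
qed

text \<open>Excludes that a pair of equal tiles and the antipodes of another such pair overlap in
  exactly one vertex: the edges from \<open>x\<close> to \<open>antipode y\<close> and from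
  \<open>y\<close> to \<open>antipode z\<close> would get equal labels.\<close>

lemma equal_tiles_crossing:
  assumes "distinct [x, y, z]" "parity z = parity x"
    and xy: "tile_at D col x = tile_at D col y"
    and xz: "tile_at D col (antipode x) = tile_at D col (antipode z)"
  shows False
proof -
  have par: "parity y = parity x"
    using assms equal_tiles_parity[of x y] by auto
  have adj: "adjacent y (antipode x)" "adjacent y (antipode z)" "adjacent x (antipode y)"
      "adjacent x (antipode z)"
    using assms par by (auto intro!: adjacent_antipode)
  have "label (antipode x) y = label (antipode z) y"
    using xz assms(1) adj by (intro equal_tiles_common_neighbor) (auto simp: adjacent_sym)
  then have "label y (antipode x) = label y (antipode z)"
    using label_flip[OF adj(1)] label_flip[OF adj(2)] by simp
  moreover have "label x (antipode y) = label y (antipode x)"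
    using assms by (intro equal_tiles_antipodes) auto
  ultimately have "label x (antipode y) = label y (antipode z)"
    by simp
  with equal_labels[OF adj(3) adj(2)] assms(1) show False by auto
qed

text \<open>Excludes that the antipodes of \<open>x\<close> and \<open>y\<close> form a pair as
  well, once \<open>z\<close> and \<open>w\<close> are paired: the edges from \<open>z\<close> to
  \<open>antipode x\<close> and from \<open>w\<close> to \<open>antipode y\<close> would get equal
  labels.\<close>

lemma equal_tiles_parallel:
  assumes "distinct [x, y, z, w]" "parity z = parity x"
    and xy: "tile_at D col x = tile_at D col y" and zw: "tile_at D col z = tile_at D col w"
    and anti: "tile_at D col (antipode x) = tile_at D col (antipode y)"
  shows False
proof -
  have par: "parity y = parity x" "parity w = parity x"
    using assms equal_tiles_parity[of x y] equal_tiles_parity[of z w] by auto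
  have adj: "adjacent z (antipode x)" "adjacent z (antipode y)" "adjacent w (antipode x)"
      "adjacent w (antipode y)"
    using assms par by (auto intro!: adjacent_antipode)
  have "label (antipode x) z = label (antipode y) z"
    using anti assms(1) adj by (intro equal_tiles_common_neighbor) (auto simp: adjacent_sym)
  then have "label z (antipode x) = label z (antipode y)"
    using label_flip[OF adj(1)] label_flip[OF adj(2)] by simp
  moreover have "label z (antipode y) = label w (antipode y)"
    using assms adj by (intro equal_tiles_common_neighbor) auto
  ultimately have "label z (antipode x) = label w (antipode y)"
    by simp
  with equal_labels[OF adj(1) adj(4)] assms(1) parity_antipode[of x] show False
    using assms by auto
qed

lemma two_pairs_opposite_tiles_distinct:
  assumes "distinct [x, y, z, w]" "parity z = parity x"
    and cover: "\<And>v. parity v = parity x \<Longrightarrow> v \<in> {x, y, z, w}"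
    and xy: "tile_at D col x = tile_at D col y" and zw: "tile_at D col z = tile_at D col w"
    and ab: "parity a \<noteq> parity x" "parity b \<noteq> parity x" "a \<noteq> b"
  shows "tile_at D col a \<noteq> tile_at D col b"
proof
  assume eq: "tile_at D col a = tile_at D col b"
  define a' b' where "a' = antipode a" and "b' = antipode b"
  have a'b': "a = antipode a'" "b = antipode b'" "a' \<noteq> b'" 
    using ab by (auto simp: a'_def b'_def)
  have para: "parity a' = parity x" "parity b' = parity x"
    using ab parity_antipode[of a] parity_antipode[of b] unfolding a'_def b'_def
    by (metis bit.exhaust)+
  from para(1) have in4: "a' \<in> {x, y, z, w}" by (rule cover)
  \<comment> \<open>By \<open>equal_tiles_crossing\<close>, \<open>b'\<close> has to be the partner
    of \<open>a'\<close> in its pair; this leaves only the situation of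
    \<open>equal_tiles_parallel\<close>.\<close>
  have partner: "b' = u'" if "a' = u" "u' \<noteq> u" "tile_at D col u' = tile_at D col u" for u u'
    using equal_tiles_crossing[of a' u' b'] that a'b' eq para by auto
  from in4 have "a' = x \<and> b' = y \<or> a' = y \<and> b' = x \<or> a' = z \<and> b' = w \<or> a' = w \<and> b' = z"
    using partner[of x y] partner[of y x] partner[of z w] partner[of w z] xy zw assms(1)
    by simp metis
  then have "tile_at D col (antipode x) = tile_at D col (antipode y) \<or>
      tile_at D col (antipode z) = tile_at D col (antipode w)"
    using eq a'b'(1,2) by (elim disjE) simp_all
  moreover have "distinct [z, w, x, y]" "parity x = parity z"
    using assms(1,2) by auto
  ultimately show False
    using equal_tiles_parallel[OF assms(1,2) xy zw] equal_tiles_parallel[OF _ _ zw xy] by blast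
qed

text \<open>Four vertices with at most two tiles and no tile three times form two pairs. Then the
  tiles on the other side, of parity \<open>1 + p\<close>, are all different.\<close>

lemma tiles_of_parity_class:
  assumes few: "card (tile_at D col ` {v. parity v = p}) < 3"
  shows "card (tile_at D col ` {v. parity v = p}) = 2"
    and "inj_on (tile_at D col) {v. parity v = 1 + p}"
proof -
  obtain x y z w where E: "{v. parity v = p} = {x, y, z, w}" and dist: "distinct [x, y, z, w]"
    by (rule parity_class)
  let ?t = "tile_at D col"
  have par: "parity x = p" "parity y = p" "parity z = p" "parity w = p"
    using equalityD2[OF E] by simp_all
  have no3: "\<not> (?t x = ?t y \<and> ?t x = ?t z)" "\<not> (?t x = ?t y \<and> ?t x = ?t w)"
    "\<not> (?t x = ?t z \<and> ?t x = ?t w)" "\<not> (?t y = ?t z \<and> ?t y = ?t w)"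
    using no_three_equal_tiles[of x y z] no_three_equal_tiles[of x y w]
      no_three_equal_tiles[of x z w] no_three_equal_tiles[of y z w] dist by auto
  have card: "card {?t x, ?t y, ?t z, ?t w} < 3"
    using few by (simp add: E)
  then have pairs: "?t x = ?t y \<and> ?t z = ?t w \<or> ?t x = ?t z \<and> ?t y = ?t w \<or> ?t x = ?t w \<and> ?t y = ?t z"
    using no3 by (auto simp: card_insert_if split: if_splits)
  then show "card (?t ` {v. parity v = p}) = 2"
    using no3 by (auto simp: E card_insert_if)
  have "?t a \<noteq> ?t b" if "parity a = 1 + p" "parity b = 1 + p" "a \<noteq> b" for a b
  proof -
    have ab: "parity a \<noteq> p" "parity b \<noteq> p" using that by (cases p; simp)+
    have cover: "v \<in> {x, y, z, w}" if "parity v = p" for v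
      using that equalityD1[OF E] by blast
    from pairs consider "?t x = ?t y" "?t z = ?t w" | "?t x = ?t z" "?t y = ?t w"
      | "?t x = ?t w" "?t y = ?t z" by blast
    then show ?thesis
    proof cases
      case 1
      then show ?thesis
        using two_pairs_opposite_tiles_distinct[of x y z w a b] dist par ab that cover by auto
    next
      case 2
      then show ?thesis
        using two_pairs_opposite_tiles_distinct[of x z y w a b] dist par ab that cover by auto
    next
      case 3
      then show ?thesis
        using two_pairs_opposite_tiles_distinct[of x w y z a b] dist par ab that cover by auto
    qed
  qed
  then show "inj_on ?t {v. parity v = 1 + p}"
    by (intro inj_onI) blast
qed

text \<open>Equal tiles have equal parity, so the numbers for the two sides add up: either both are
  at least 3, or one is 2 and the other 4.\<close>

lemma six_tiles: "card (range (tile_at D col)) \<ge> 6"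
proof -
  let ?t = "tile_at D col" and ?E = "\<lambda>p. {v. parity v = p}"
  have "parity v = 0 \<or> parity v = 1" for v
    by (cases "parity v") simp_all
  then have "UNIV = ?E 0 \<union> ?E 1"
    by blast
  then have "range ?t = ?t ` ?E 0 \<union> ?t ` ?E 1"
    by (metis image_Un)
  moreover have "?t u \<noteq> ?t v" if "parity u = 0" "parity v = 1" for u v
    using equal_tiles_parity[of u v] that by (cases "u = v") auto
  then have "?t ` ?E 0 \<inter> ?t ` ?E 1 = {}"
    by blast
  ultimately have card: "card (range ?t) = card (?t ` ?E 0) + card (?t ` ?E 1)"
    by (simp add: card_Un_disjoint)
  have "card (?t ` ?E p) \<ge> 3 \<or> card (?t ` ?E p) = 2 \<and> card (?t ` ?E (1 + p)) = 4" for p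
    using tiles_of_parity_class[of p] card_parity_class[of "1 + p"] by (auto simp: card_image not_less)
  from this[of 0] this[of 1] show ?thesis
    using card by auto
qed

section \<open>At least five colors\<close>

text \<open>Let two arcs of one color be related antipodally, as x -> y and
  \<open>antipode y\<close> -> \<open>antipode x\<close>. An arc u -> v that
  \<open>equal_color_arcs\<close> allows beside both is one of the two.\<close>

lemma antipodal_arcs_closed:
  assumes "y \<noteq> antipode x" "v \<noteq> antipode u"
    and "x = u \<or> y = v \<or> v = antipode x \<and> y = antipode u"
    and "antipode y = u \<or> antipode x = v \<or> v = y \<and> x = u"
  shows "u = x \<and> v = y \<or> u = antipode y \<and> v = antipode x"
proof -
  have "antipode y = u \<longleftrightarrow> y = antipode u" by auto
  with assms show ?thesis by metis
qed

lemma arc_eqI: "e \<in> arcs D \<Longrightarrow> e' \<in> arcs D \<Longrightarrow> tail D e = tail D e' \<Longrightarrow> head D e = head D e' \<Longrightarrow> e = e'"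
  by (metis arc_eq)

text \<open>An antipodally related pair would be the whole class, so with three arcs any two share a
  tail or a head. Two arcs with the same tail have different heads, which forces that tail on every
  further arc; dually for heads.\<close>

lemma color_class_star:
  assumes F: "F = {e \<in> arcs D. col e = n}" and "card F \<ge> 3"
  shows "(\<exists>x. \<forall>e\<in>F. tail D e = x) \<or> (\<exists>x. \<forall>e\<in>F. head D e = x)"
proof -
  have eq: "tail D e = tail D e' \<or> head D e = head D e' \<or>
      head D e' = antipode (tail D e) \<and> head D e = antipode (tail D e')" if "e \<in> F" "e' \<in> F" for e e'
    using equal_color_arcs that by (auto simp: F)
  have adj: "adjacent (tail D e) (head D e)" if "e \<in> F" for e
    using adjacent_arc that by (auto simp: F)
  have inj: "e = e'" if "e \<in> F" "e' \<in> F" "tail D e = tail D e'" "head D e = head D e'" for e e'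
    using arc_eqI that by (auto simp: F)
  have share: "tail D e = tail D e' \<or> head D e = head D e'" if e: "e \<in> F" "e' \<in> F" for e e'
  proof (rule ccontr)
    assume ne: "\<not> ?thesis"
    have "F \<subseteq> {e, e'}"
    proof
      fix d assume d: "d \<in> F"
      have e': "head D e' = antipode (tail D e)" "tail D e' = antipode (head D e)"
        using eq[OF e] ne by auto
      have "head D e \<noteq> antipode (tail D e)" "head D d \<noteq> antipode (tail D d)"
        using adj[OF e(1)] adj[OF d] by (simp_all add: adjacent_def)
      moreover have "tail D e = tail D d \<or> head D e = head D d \<or>
          head D d = antipode (tail D e) \<and> head D e = antipode (tail D d)"
        by (rule eq[OF e(1) d])
      moreover have "antipode (head D e) = tail D d \<or> antipode (tail D e) = head D d \<or>
          head D d = head D e \<and> tail D e = tail D d"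
        using eq[OF e(2) d] unfolding e' antipode_antipode antipode_inject .
      ultimately have "tail D d = tail D e \<and> head D d = head D e \<or>
          tail D d = tail D e' \<and> head D d = head D e'"
        unfolding e' by (rule antipodal_arcs_closed)
      then show "d \<in> {e, e'}"
        using inj d e by blast
    qed
    then have "card F \<le> card {e, e'}"
      by (rule card_mono[rotated]) simp
    also have "\<dots> \<le> 2"
      by (simp add: card_insert_if)
    finally show False using assms(2) by simp
  qed
  obtain e e' where e: "e \<in> F" "e' \<in> F" "e \<noteq> e'"
  proof -
    obtain T where "T \<subseteq> F" "card T = 2"
      using obtain_subset_with_card_n[of 2 F] assms(2) by auto
    then show thesis using that by (auto simp: card_2_iff)
  qed
  show ?thesis
  proof (cases "tail D e = tail D e'")
    case True
    then have "head D e \<noteq> head D e'" using inj e by auto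
    then have "\<forall>d\<in>F. tail D d = tail D e" using share e True by metis
    then show ?thesis by blast
  next
    case False
    then have "head D e = head D e'" using share e by auto
    then have "\<forall>d\<in>F. head D d = head D e" using share e False by metis
    then show ?thesis by blast
  qed
qed

text \<open>Labels are signed: the three edges at \<open>x\<close> have one color and all leave or
  all enter \<open>x\<close>.\<close>

definition monochromatic :: "cube_vertex \<Rightarrow> bool" where
  "monochromatic x \<longleftrightarrow> (\<exists>t. \<forall>a\<in>neighbors x. label x a = t)"

lemma card_star: "card (Upair x ` neighbors x) = 3"
  by (simp add: card_image inj_on_def card_neighbors)

lemma color_class_subset_star:
  assumes F: "F = {e \<in> arcs D. col e = n}" and "card F \<ge> 3"
  obtains x t where "F \<subseteq> Upair x ` neighbors x"
    "\<And>a. a \<in> neighbors x \<Longrightarrow> Upair x a \<in> F \<Longrightarrow> label x a = t"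
  using color_class_star[OF assms]
proof (elim disjE exE)
  fix x assume x: "\<forall>e\<in>F. tail D e = x"
  show thesis
  proof (rule that[of x "int n"])
    show "F \<subseteq> Upair x ` neighbors x"
    proof
      fix e assume "e \<in> F"
      then have "e = Upair x (head D e)" "head D e \<in> neighbors x"
        using x arc_eq[of e] adjacent_arc[of e] by (auto simp: F neighbors_def)
      then show "e \<in> Upair x ` neighbors x" by blast
    qed
    show "label x a = int n" if "Upair x a \<in> F" for a
      using that x by (auto simp: label_def F)
  qed
next
  fix x assume x: "\<forall>e\<in>F. head D e = x"
  have t: "tail D e \<noteq> x" if "e \<in> F" for e
    using that x adjacent_arc[of e] by (auto simp: F adjacent_def)
  show thesis
  proof (rule that[of x "- int n"])
    show "F \<subseteq> Upair x ` neighbors x"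
    proof
      fix e assume "e \<in> F"
      then have "e = Upair x (tail D e)" "tail D e \<in> neighbors x"
        using x arc_eq[of e] adjacent_arc[of e] Upair_commute[of "tail D e" x]
        by (simp_all only: F neighbors_def mem_Collect_eq adjacent_sym[of x])
      then show "e \<in> Upair x ` neighbors x" by blast
    qed
    show "label x a = - int n" if "Upair x a \<in> F" for a
      using that t[OF that] by (simp add: label_def F)
  qed
qed

lemma card_color_class_le: "card {e \<in> arcs D. col e = n} \<le> 3"
proof (rule ccontr)
  assume not: "\<not> card {e \<in> arcs D. col e = n} \<le> 3"
  then have "card {e \<in> arcs D. col e = n} \<ge> 3" by simp
  from color_class_subset_star[OF refl this] obtain x where "{e \<in> arcs D. col e = n} \<subseteq> Upair x ` neighbors x"
    by blast
  from card_mono[OF _ this] show False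
    using not card_star[of x] by simp
qed

text \<open>A class of three edges inside a star of three edges is the whole star, and its center is
  monochromatic.\<close>

lemma full_color_class:
  assumes e: "e \<in> arcs D" and 3: "card {d \<in> arcs D. col d = col e} = 3"
  obtains x a where "e = Upair x a" "adjacent x a" "monochromatic x"
proof -
  let ?F = "{d \<in> arcs D. col d = col e}"
  from 3 have "card ?F \<ge> 3" by simp
  from color_class_subset_star[OF refl this] obtain x t where x: "?F \<subseteq> Upair x ` neighbors x"
    and lab: "\<And>a. a \<in> neighbors x \<Longrightarrow> Upair x a \<in> ?F \<Longrightarrow> label x a = t"
    by blast
  have F: "?F = Upair x ` neighbors x"
    by (rule card_seteq[OF _ x]) (simp_all add: 3 card_star)
  have "e \<in> ?F" using e by simp
  then obtain a where "e = Upair x a" "a \<in> neighbors x"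
    using x by blast
  moreover have "monochromatic x"
    unfolding monochromatic_def using lab F by blast
  ultimately show thesis
    using that[of x a] by (simp only: neighbors_def mem_Collect_eq)
qed

text \<open>The common label would pass along the edge between \<open>x\<close> and
  \<open>a\<close>: a further edge from \<open>x\<close> to \<open>b\<close> and one from
  \<open>y\<close> to \<open>a\<close> would get equal labels, although \<open>a\<close> is not the
  antipode of \<open>x\<close>.\<close>

lemma adjacent_not_both_monochromatic:
  assumes "adjacent x a" "monochromatic x"
  shows "\<not> monochromatic a"
proof
  assume "monochromatic a"
  have "\<exists>b \<in> neighbors x. b \<noteq> a" for x a
    by (rule neighbors_distinct[of x]) auto
  then obtain b y where b: "b \<in> neighbors x" "b \<noteq> a" and y: "y \<in> neighbors a" "y \<noteq> x"
    by metis
  have "a \<in> neighbors x" "x \<in> neighbors a"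
    using assms(1) adjacent_sym[of x a] by (simp_all add: neighbors_def)
  then have "label x b = label x a" "label a y = label a x"
    using assms(2) \<open>monochromatic a\<close> b y unfolding monochromatic_def by metis+
  then have "label x b = label y a"
    using label_flip[OF assms(1)] label_flip[of a y] y by (simp add: neighbors_def)
  then show False
    using equal_labels[of x b y a] b y assms(1) adjacent_sym[of a y]
    by (auto simp: neighbors_def adjacent_def)
qed

text \<open>Three copies of the tile at \<open>w\<close> and the three monochromatic tiles at its neighbors assemble
  into \<open>K\<^sub>3\<^sub>,\<^sub>3\<close>, which has fewer vertices than the cube.\<close>

lemma not_all_neighbors_monochromatic:
  assumes mono: "\<And>n. n \<in> neighbors w \<Longrightarrow> monochromatic n"
  shows False
proof -
  \<comment> \<open>\<open>Inl n\<close> is a neighbor of \<open>w\<close> and \<open>Inr k\<close>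
    a copy of \<open>w\<close>; the arc \<open>(n, k)\<close> copies direction and color of the edge
    between \<open>n\<close> and \<open>w\<close>.\<close>
  define K :: "(cube_vertex + nat, cube_vertex \<times> nat) pre_digraph" where
    "K = \<lparr>verts = Inl ` neighbors w \<union> Inr ` {0, 1, 2}, arcs = neighbors w \<times> {0, 1, 2},
      tail = (\<lambda>(n, k). if label n w > 0 then Inl n else Inr k),
      head = (\<lambda>(n, k). if label n w > 0 then Inr k else Inl n)\<rparr>"
  define \<kappa> :: "cube_vertex \<times> nat \<Rightarrow> nat" where "\<kappa> = (\<lambda>(n, k). nat \<bar>label n w\<bar>)"
  have fin: "finite (arcs K)" by (simp add: K_def)
  have card: "card (verts K) = 6"
    unfolding K_def pre_digraph.simps
    by (subst card_Un_disjoint) (auto simp: card_image card_neighbors)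
  have label: "label n w \<noteq> 0" "label n w = - label w n" if "n \<in> neighbors w" for n
    using that label_nonzero[of n w] label_flip[of w n] adjacent_sym by (auto simp: neighbors_def)
  have nbr: "w \<in> neighbors n" if "n \<in> neighbors w" for n
    using that adjacent_sym by (auto simp: neighbors_def)
  \<comment> \<open>In either direction, the arc contributes \<open>label n w\<close> at
    \<open>Inl n\<close> and the opposite value \<open>label w n\<close> at
    \<open>Inr k\<close>.\<close>
  have arc: "(if tail K e = v then {#int (\<kappa> e)#} else {#}) + (if head K e = v then {#- int (\<kappa> e)#} else {#}) =
      (case e of (n, k) \<Rightarrow> (if v = Inl n then {#label n w#} else {#}) + (if v = Inr k then {#label w n#} else {#}))"
    if e: "e \<in> neighbors w \<times> {0, 1, 2}" for e v
  proof -
    obtain n k where "e = (n, k)" "n \<in> neighbors w" using e by auto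
    then show ?thesis
      using label[of n] by (cases "label n w > 0") (auto simp: K_def \<kappa>_def)
  qed
  have sum: "tile_at K \<kappa> v = (\<Sum>n\<in>neighbors w. \<Sum>k\<in>{0, 1, 2}.
      (if v = Inl n then {#label n w#} else {#}) + (if v = Inr k then {#label w n#} else {#}))" for v
    unfolding tile_at_eq_sum[OF fin] sum.distrib[symmetric] sum.cartesian_product
    by (rule sum.cong) (simp add: K_def, rule arc)
  have tile_Inl: "tile_at K \<kappa> (Inl n) = tile_at D col n" if "n \<in> neighbors w" for n
  proof -
    have "tile_at K \<kappa> (Inl n) = {#label n w, label n w, label n w#}"
      using that by (simp add: sum sum.distrib sum.delta')
    moreover have "label n a = label n w" if "a \<in> neighbors n" for a
      using that mono[OF \<open>n \<in> neighbors w\<close>] nbr[OF \<open>n \<in> neighbors w\<close>]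
      by (auto simp: monochromatic_def)
    then have "tile_at D col n = (\<Sum>a\<in>neighbors n. {#label n w#})"
      unfolding tile_at_cube by (intro sum.cong) auto
    then have "tile_at D col n = {#label n w, label n w, label n w#}"
      by (rule_tac neighbors_distinct[of n]) auto
    ultimately show ?thesis by simp
  qed
  have tile_Inr: "tile_at K \<kappa> (Inr k) = tile_at D col w" if "k \<in> {0, 1, 2}" for k
    unfolding sum tile_at_cube by (rule sum.cong) (use that in auto)
  have "multigraph_of K \<simeq>\<^sub>G cube"
  proof (rule three_realizes_competitor[OF three_realizes])
    show "fin_digraph K"
      by unfold_locales (auto simp: K_def split: if_splits)
    show "verts K \<noteq> {}"
      by (simp add: K_def)
    show "edge_coloring K (Max (\<kappa> ` arcs K)) \<kappa>"
      unfolding edge_coloring_def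
    proof
      fix e assume e: "e \<in> arcs K"
      then have "\<kappa> e > 0" using label by (auto simp: K_def \<kappa>_def)
      with e fin show "\<kappa> e \<in> {1..Max (\<kappa> ` arcs K)}" by simp
    qed
    have "tile_at D col x \<in> P" for x
      using pot by (auto simp: induced_pot_def)
    then show "induced_pot K \<kappa> \<subseteq> P"
      using tile_Inl tile_Inr by (auto simp: induced_pot_def K_def)
    show "card (verts K) \<le> card (vertices cube)"
      using card card_cube_vertices by simp
  qed
  from multigraph_iso_card[OF this] show False
    using card card_cube_vertices by simp
qed

text \<open>Twelve edges in at most four classes of at most three make every class full, so every
  edge has a monochromatic end. Some vertex is not monochromatic, and then all its neighbors
  are.\<close>

lemma five_colors: "card (col ` arcs D) \<ge> 5"
proof (rule ccontr)
  assume "\<not> ?thesis"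
  then have le: "card (col ` arcs D) \<le> 4" by simp
  let ?F = "\<lambda>n. {e \<in> arcs D. col e = n}"
  have "card (arcs D) = (\<Sum>n\<in>col ` arcs D. card (?F n))"
    using sum.image_gen[of "arcs D" "\<lambda>_. 1::nat" col] by simp
  then have total: "(\<Sum>n\<in>col ` arcs D. card (?F n)) = 12"
    by (simp add: arcs_D card_edges_cube)
  have full: "card (?F (col e)) = 3" if "e \<in> arcs D" for e
  proof (rule ccontr)
    assume "card (?F (col e)) \<noteq> 3"
    then have "card (?F (col e)) < 3"
      using card_color_class_le[of "col e"] by simp
    then have "(\<Sum>n\<in>col ` arcs D. card (?F n)) < (\<Sum>n\<in>col ` arcs D. 3)"
      using that card_color_class_le by (intro sum_strict_mono_ex1) auto
    then show False using total le by simp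
  qed
  have ex: "monochromatic x \<or> monochromatic a" if "adjacent x a" for x a
  proof -
    note arc = edge_arc(1)[OF that]
    obtain y b where "Upair x a = Upair y b" "monochromatic y"
      by (rule full_color_class[OF arc full[OF arc]])
    then show ?thesis by auto
  qed
  obtain a where "adjacent 0 a"
    by (rule neighbors_distinct[of 0]) (auto simp: neighbors_def)
  then obtain w where "\<not> monochromatic w"
    using adjacent_not_both_monochromatic by blast
  then show False
    using ex not_all_neighbors_monochromatic[of w] unfolding neighbors_def by blast
qed

end

section \<open>The lower bounds for tiles and colors\<close>

lemma three_realizes_cube_lower_bounds:
  assumes "three_realizes P cube"
  shows "finite P \<Longrightarrow> 6 \<le> card P" and "finite (colors P) \<Longrightarrow> 5 \<le> card (colors P)"
proof -
  from assms obtain D c col where "orientation D cube" "edge_coloring D c col" "induced_pot D col \<subseteq> P"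
    by (auto simp: three_realizes_def realized_def)
  with assms interpret three_realizing_coloring D c col P by unfold_locales
  have range: "range (tile_at D col) \<subseteq> P"
    using pot by (simp add: induced_pot_def)
  show "6 \<le> card P" if "finite P"
    using card_mono[OF that range] six_tiles by simp
  \<comment> \<open>\<open>colors\<close> looks at positive entries only; each used color occurs
    positively at the tail of its arc.\<close>
  have sub: "col ` arcs D \<subseteq> colors P"
  proof
    fix n assume "n \<in> col ` arcs D"
    then obtain e where e: "e \<in> arcs D" "n = col e" by auto
    then have "int n \<in># tile_at D col (tail D e)"
      using label_arc(1)[OF e(1)] adjacent_arc[OF e(1)] in_tile_at_cube by metis
    then show "n \<in> colors P"
      using range e color_pos by (auto simp: colors_def)
  qed
  show "5 \<le> card (colors P)" if "finite (colors P)"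
    using card_mono[OF that sub] five_colors by simp
qed

section \<open>The pot\<close>

abbreviation pot2 :: pot where
  "pot2 \<equiv> {{#1, 1, 1#}, {#2, 2, 2#}, {#-2, -3, -3#}, {#-1, -4, -4#}, {#3, 4, 5#}, {#-1, -2, -5#}}"

lemma colors_pot2: "colors pot2 = {1, 2, 3, 4, 5}"
  unfolding colors_def by auto

text \<open>The color of the edge from the even vertex \<open>x\<close> to the odd vertex \<open>a\<close>.\<close>

definition pot2_color :: "cube_vertex \<Rightarrow> cube_vertex \<Rightarrow> nat" where
  "pot2_color x a =
    (if x = (0, 0, 0) then 1 else if x = (0, 1, 1) then 2
     else if a = (1, 1, 1) then 3 else if a = (1, 0, 0) then 4 else 5)"

lemma connected_cube: "connected_multigraph cube"
proof
  show "(x, y) \<in> (adjacency cube)\<^sup>*" for x y :: cube_vertex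
  proof -
    obtain a b c where x: "x = (a, b, c)" by (cases x)
    obtain a' b' c' where y: "y = (a', b', c')" by (cases y)
    have step: "(u, v) \<in> (adjacency cube)\<^sup>*" if "u = v \<or> v \<in> neighbors u" for u v
    proof (cases "u = v")
      case False
      then have "(u, v) \<in> adjacency cube"
        using that Upair_in_edges_cube[of u v] by (simp add: adjacency_def neighbors_def)
      then show ?thesis by blast
    qed simp
    \<comment> \<open>The coordinates are changed one at a time.\<close>
    have "(a, b, c) = (a', b, c) \<or> (a', b, c) \<in> neighbors (a, b, c)"
      "(a', b, c) = (a', b', c) \<or> (a', b', c) \<in> neighbors (a', b, c)"
      "(a', b', c) = (a', b', c') \<or> (a', b', c') \<in> neighbors (a', b', c)"
      unfolding neighbors_eq
      by (cases a; cases a'; cases b; cases b'; cases c; cases c'; simp)+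
    from this[THEN step] show ?thesis
      unfolding x y by (meson rtrancl_trans)
  qed
qed (simp_all add: finite_edges_cube)

lemma cube_realized_by_pot2: "cube \<in> \<O> pot2"
proof -
  \<comment> \<open>All edges are directed from their even to their odd end. On edges of the cube
    the descriptions are unique, because adjacent vertices differ in parity.\<close>
  define even_end where "even_end e = (THE x. x \<in> set_uprod e \<and> parity x = 0)" for e
  define odd_end where "odd_end e = (THE x. x \<in> set_uprod e \<and> parity x = 1)" for e
  define D :: "(cube_vertex, cube_vertex uprod) pre_digraph" where
    "D = \<lparr>verts = UNIV, arcs = edges cube, tail = even_end, head = odd_end\<rparr>"
  define col where "col e = pot2_color (even_end e) (odd_end e)" for e
  have ends: "even_end (Upair x a) = (if parity x = 0 then x else a)"
    "odd_end (Upair x a) = (if parity x = 0 then a else x)" if "adjacent x a" for x a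
    using that by (cases "parity x"; cases "parity a";
        auto simp: even_end_def odd_end_def adjacent_def intro!: the_equality)+
  have or: "orientation D cube"
    by (auto simp: orientation_def D_def edges_cube ends)
  have co: "edge_coloring D 5 col"
    by (auto simp: edge_coloring_def D_def col_def pot2_color_def)
  interpret oriented_cube D 5 col
    using or co by unfold_locales
  have label: "label x a = (if parity x = 0 then int (pot2_color x a) else - int (pot2_color a x))"
    if "a \<in> neighbors x" for x a
  proof -
    have "tail D = even_end" by (simp add: D_def)
    then show ?thesis
      using that ends[of x a] unfolding label_def col_def
      by (cases "parity x"; cases "parity a") (auto simp: neighbors_def adjacent_def)
  qed
  have tile: "tile_at D col x = (\<Sum>a\<in>neighbors x. {#if parity x = 0 then int (pot2_color x a) else - int (pot2_color a x)#})" for x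
    unfolding tile_at_cube by (rule sum.cong) (simp_all add: label)
  have "\<forall>p q r. tile_at D col (p, q, r) \<in> pot2"
    unfolding tile neighbors_eq all_bit by (simp add: parity_def pot2_color_def)
  then have "induced_pot D col \<subseteq> pot2"
    unfolding induced_pot_def by (metis image_subsetI prod_cases3)
  then show ?thesis
    using connected_cube or co unfolding realized_def by blast
qed

section \<open>Counting the tiles in a graph realized by the pot\<close>

lemma sum_by_tile:
  fixes g :: "tile \<Rightarrow> nat"
  assumes "finite V" "finite P" "t ` V \<subseteq> P"
  shows "(\<Sum>v\<in>V. g (t v)) = (\<Sum>s\<in>P. card {v \<in> V. t v = s} * g s)"
proof -
  have "(\<Sum>v\<in>V. g (t v)) = (\<Sum>s\<in>P. \<Sum>v\<in>{v \<in> V. t v = s}. g (t v))"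
    by (rule sum.group[symmetric]) (use assms in auto)
  also have "\<dots> = (\<Sum>s\<in>P. card {v \<in> V. t v = s} * g s)"
    by (rule sum.cong) auto
  finally show ?thesis .
qed

text \<open>Each arc of color \<open>n\<close> yields one \<open>n\<close> at its tail and one
  \<open>- n\<close> at its head, so both kinds of entries are equally frequent.\<close>

lemma (in fin_digraph) sum_count_tile_at:
  assumes "edge_coloring G c col" "n > 0"
  shows "(\<Sum>v\<in>verts G. count (tile_at G col v) (int n)) = card {e \<in> arcs G. col e = n}"
    and "(\<Sum>v\<in>verts G. count (tile_at G col v) (- int n)) = card {e \<in> arcs G. col e = n}"
proof -
  let ?F = "{e \<in> arcs G. col e = n}"
  have "(\<Sum>v\<in>verts G. count (tile_at G col v) (int n)) = (\<Sum>v\<in>verts G. \<Sum>e\<in>{e \<in> ?F. tail G e = v}. 1)"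
    by (rule sum.cong) (auto simp: count_tile_at[OF finite_arcs assms(2,1)] intro!: arg_cong[of _ _ card])
  also have "\<dots> = (\<Sum>e\<in>?F. 1)"
    by (rule sum.group) auto
  finally show "(\<Sum>v\<in>verts G. count (tile_at G col v) (int n)) = card ?F" by simp
  have "(\<Sum>v\<in>verts G. count (tile_at G col v) (- int n)) = (\<Sum>v\<in>verts G. \<Sum>e\<in>{e \<in> ?F. head G e = v}. 1)"
    by (rule sum.cong) (auto simp: count_tile_at[OF finite_arcs assms(2,1)] intro!: arg_cong[of _ _ card])
  also have "\<dots> = (\<Sum>e\<in>?F. 1)"
    by (rule sum.group) auto
  finally show "(\<Sum>v\<in>verts G. count (tile_at G col v) (- int n)) = card ?F" by simp
qed

lemma sum_pot2:
  fixes h :: "tile \<Rightarrow> nat"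
  shows "sum h pot2 = h {#1, 1, 1#} + h {#2, 2, 2#} + h {#-2, -3, -3#} + h {#-1, -4, -4#} +
    h {#3, 4, 5#} + h {#-1, -2, -5#}"
proof -
  let ?l = "[{#1, 1, 1#}, {#2, 2, 2#}, {#-2, -3, -3#}, {#-1, -4, -4#}, {#3, 4, 5#}, {#-1, -2, -5#}] :: tile list"
  \<comment> \<open>The multiplicities of five suitable entries tell the six tiles apart.\<close>
  have "distinct (map (\<lambda>t. (count t 1, count t 2, count t (-3), count t (-4), count t (-5))) ?l)"
    by simp
  then have "distinct ?l"
    by (simp only: distinct_map)
  then have "sum h (set ?l) = sum_list (map h ?l)"
    by (simp only: sum_list_distinct_conv_sum_set)
  then show ?thesis by simp
qed

lemma card_pot2: "card pot2 = 6"
  using sum_pot2[of "\<lambda>_. 1"] by (simp only: card_eq_sum)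

text \<open>With \<open>N {#-2, -3, -3#}\<close> = c, the balance of the five colors gives c also
  for \<open>{#-1, -4, -4#}\<close>, \<open>{#1, 1, 1#}\<close> and \<open>{#2, 2, 2#}\<close>, and
  2c for the other two tiles. The total 8c is positive and at most 8, so c = 1.\<close>

lemma pot2_tile_counts:
  assumes H: "fin_digraph G" and col: "edge_coloring G c col" and pot: "induced_pot G col \<subseteq> pot2"
    and "verts G \<noteq> {}" "card (verts G) \<le> 8"
  defines "N \<equiv> \<lambda>t. card {v \<in> verts G. tile_at G col v = t}"
  shows "N {#1, 1, 1#} = 1" "N {#2, 2, 2#} = 1" "N {#-2, -3, -3#} = 1" "N {#-1, -4, -4#} = 1"
    "N {#3, 4, 5#} = 2" "N {#-1, -2, -5#} = 2"
proof -
  interpret fin_digraph G by fact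
  have tiles: "tile_at G col ` verts G \<subseteq> pot2" using pot by (simp add: induced_pot_def)
  have sum: "(\<Sum>v\<in>verts G. g (tile_at G col v)) = sum (\<lambda>t. N t * g t) pot2" for g :: "tile \<Rightarrow> nat"
    unfolding N_def by (rule sum_by_tile[OF finite_verts _ tiles]) simp
  have bal: "sum (\<lambda>t. N t * count t (int n)) pot2 = sum (\<lambda>t. N t * count t (- int n)) pot2" if "n > 0" for n
    using sum_count_tile_at[OF col that] sum[of "\<lambda>t. count t (int n)"] sum[of "\<lambda>t. count t (- int n)"]
    by simp
  have 1: "3 * N {#1, 1, 1#} = N {#-1, -4, -4#} + N {#-1, -2, -5#}"
    using bal[of 1] unfolding sum_pot2 by simp
  have 2: "3 * N {#2, 2, 2#} = N {#-2, -3, -3#} + N {#-1, -2, -5#}"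
    using bal[of 2] unfolding sum_pot2 by simp
  have 3: "N {#3, 4, 5#} = 2 * N {#-2, -3, -3#}"
    using bal[of 3] unfolding sum_pot2 by simp
  have 4: "N {#3, 4, 5#} = 2 * N {#-1, -4, -4#}"
    using bal[of 4] unfolding sum_pot2 by simp
  have 5: "N {#3, 4, 5#} = N {#-1, -2, -5#}"
    using bal[of 5] unfolding sum_pot2 by simp
  have 6: "card (verts G) = N {#1, 1, 1#} + N {#2, 2, 2#} + N {#-2, -3, -3#} + N {#-1, -4, -4#} +
      N {#3, 4, 5#} + N {#-1, -2, -5#}"
    using sum[of "\<lambda>_. 1"] unfolding sum_pot2 by simp
  have "card (verts G) > 0" using assms(4) by (simp add: card_gt_0_iff)
  then have c: "N {#-2, -3, -3#} = 1"
    using 1 2 3 4 5 6 assms(5) by linarith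
  then show "N {#1, 1, 1#} = 1" "N {#2, 2, 2#} = 1" "N {#-2, -3, -3#} = 1" "N {#-1, -4, -4#} = 1"
    "N {#3, 4, 5#} = 2" "N {#-1, -2, -5#} = 2"
    using 1 2 3 4 5 by linarith+
qed

text \<open>The eight vertices are named by their tiles. The colors then determine all connections
  up to the choice of which \<open>{#-1, -2, -5#}\<close> vertex is joined to which
  \<open>{#3, 4, 5#}\<close> vertex by color 5, and the naming absorbs this choice.\<close>

lemma pot2_realizes_only_cube:
  fixes G :: "('v, 'e) pre_digraph"
  assumes H: "fin_digraph G" and col: "edge_coloring G c col" and pot: "induced_pot G col \<subseteq> pot2"
    and ne: "verts G \<noteq> {}" and le: "card (verts G) \<le> 8"
  shows "multigraph_of G \<simeq>\<^sub>G cube"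
proof -
  interpret fin_digraph G by fact
  let ?t = "tile_at G col"
  let ?V = "\<lambda>t. {v \<in> verts G. ?t v = t}"
  note N = pot2_tile_counts[OF H col pot ne le]
  obtain A where A: "?V {#1, 1, 1#} = {A}" using N(1) by (rule card_1_singletonE)
  obtain B where B: "?V {#2, 2, 2#} = {B}" using N(2) by (rule card_1_singletonE)
  obtain C where C: "?V {#-2, -3, -3#} = {C}" using N(3) by (rule card_1_singletonE)
  obtain D where D: "?V {#-1, -4, -4#} = {D}" using N(4) by (rule card_1_singletonE)
  note ABCD = A B C D
  obtain E E' where E: "?V {#3, 4, 5#} = {E, E'}" "E \<noteq> E'"
    using N(5) by (auto simp: card_2_iff)
  obtain F0 F0' where F0: "?V {#-1, -2, -5#} = {F0, F0'}" "F0 \<noteq> F0'"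
    using N(6) by (auto simp: card_2_iff)
  have out: "card {e \<in> arcs G. tail G e = v \<and> col e = n} = count (?t v) (int n)" if "n > 0" for v n
    using count_tile_at(1)[OF finite_arcs that col] by simp
  have "in": "card {e \<in> arcs G. head G e = v \<and> col e = n} = count (?t v) (- int n)" if "n > 0" for v n
    using count_tile_at(2)[OF finite_arcs that col] by simp
  have pos: "col e > 0" if "e \<in> arcs G" for e
    using col that by (auto simp: edge_coloring_def)
  have out_tile: "int (col e) \<in># ?t (tail G e)" if "e \<in> arcs G" for e
  proof -
    have "card {d \<in> arcs G. tail G d = tail G e \<and> col d = col e} > 0"
      using that by (auto simp: card_gt_0_iff)
    then show ?thesis
      unfolding out[OF pos[OF that]] by (simp only: count_greater_zero_iff)
  qed
  have in_tile: "- int (col e) \<in># ?t (head G e)" if "e \<in> arcs G" for e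
  proof -
    have "card {d \<in> arcs G. head G d = head G e \<and> col d = col e} > 0"
      using that by (auto simp: card_gt_0_iff)
    then show ?thesis
      unfolding "in"[OF pos[OF that]] by (simp only: count_greater_zero_iff)
  qed
  have tE: "?t E = {#3, 4, 5#}" "?t E' = {#3, 4, 5#}"
    using equalityD2[OF E(1)] by simp_all
  have unique_out: "e = e'" if "e \<in> arcs G" "e' \<in> arcs G" "tail G e = tail G e'" "col e = col e'"
      "count (?t (tail G e)) (int (col e)) \<le> 1" for e e'
  proof -
    have "card {d \<in> arcs G. tail G d = tail G e \<and> col d = col e} \<le> Suc 0"
      using out[OF pos[OF that(1)], of "tail G e"] that(5) by simp
    then show ?thesis
      using that by (subst (asm) card_le_Suc0_iff_eq) auto
  qed
  have unique_in: "e = e'" if "e \<in> arcs G" "e' \<in> arcs G" "head G e = head G e'" "col e = col e'"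
      "count (?t (head G e)) (- int (col e)) \<le> 1" for e e'
  proof -
    have "card {d \<in> arcs G. head G d = head G e \<and> col d = col e} \<le> Suc 0"
      using "in"[OF pos[OF that(1)], of "head G e"] that(5) by simp
    then show ?thesis
      using that by (subst (asm) card_le_Suc0_iff_eq) auto
  qed
  have "card {e \<in> arcs G. tail G e = E \<and> col e = 5} = 1"
    using out[of 5 E] by (simp add: tE)
  then have "{e \<in> arcs G. tail G e = E \<and> col e = 5} \<noteq> {}"
    by (metis card.empty zero_neq_one)
  then obtain e5 where e5: "e5 \<in> arcs G" "tail G e5 = E" "col e5 = 5"
    by blast
  have "?t ` verts G \<subseteq> pot2"
    using pot by (simp add: induced_pot_def)
  then have "verts G = ?V {#1, 1, 1#} \<union> ?V {#2, 2, 2#} \<union> ?V {#-2, -3, -3#} \<union> ?V {#-1, -4, -4#} \<union>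
      ?V {#3, 4, 5#} \<union> ?V {#-1, -2, -5#}"
    by blast
  then have V0: "verts G = {A, B, C, D, E, E', F0, F0'}"
    unfolding ABCD E(1) F0(1) by auto
  have t0: "?t A = {#1, 1, 1#}" "?t B = {#2, 2, 2#}" "?t C = {#-2, -3, -3#}" "?t D = {#-1, -4, -4#}"
      "?t F0 = {#-1, -2, -5#}" "?t F0' = {#-1, -2, -5#}"
    using ABCD[THEN equalityD2] equalityD2[OF F0(1)] by simp_all
  have "head G e5 = A \<or> head G e5 = B \<or> head G e5 = C \<or> head G e5 = D \<or> head G e5 = E \<or>
      head G e5 = E' \<or> head G e5 = F0 \<or> head G e5 = F0'"
    using head_in_verts[OF e5(1)] unfolding V0 by simp
  then have "head G e5 = F0 \<or> head G e5 = F0'"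
    using in_tile[OF e5(1)] unfolding e5(3) by (elim disjE) (simp_all add: t0 tE)
  \<comment> \<open>\<open>F\<close> is the head of the arc of color 5 that leaves
    \<open>E\<close>.\<close>
  then obtain F F' where F: "{F, F'} = {F0, F0'}" "F \<noteq> F'" "head G e5 = F"
    using F0(2) by (metis insert_commute)
  then have t: "?t A = {#1, 1, 1#}" "?t B = {#2, 2, 2#}" "?t C = {#-2, -3, -3#}" "?t D = {#-1, -4, -4#}"
      "?t F = {#-1, -2, -5#}" "?t F' = {#-1, -2, -5#}" "?t E = {#3, 4, 5#}" "?t E' = {#3, 4, 5#}"
    using t0 tE by (auto simp: doubleton_eq_iff)
  have V: "verts G = {A, B, C, D, E, E', F, F'}"
    unfolding V0 F(1) ..
  have Vcases: "v = A \<or> v = B \<or> v = C \<or> v = D \<or> v = E \<or> v = E' \<or> v = F \<or> v = F'" if "v \<in> verts G" for v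
    using that unfolding V by simp
  \<comment> \<open>Non-adjacent opposite tiles, such as those at \<open>A\<close> and \<open>C\<close>, go to antipodal vertices.\<close>
  define f :: "'v \<Rightarrow> cube_vertex" where "f v =
    (if v = A then (0, 0, 0) else if v = B then (0, 1, 1) else if v = E then (1, 0, 1)
     else if v = E' then (1, 1, 0) else if v = C then (1, 1, 1) else if v = D then (1, 0, 0)
     else if v = F then (0, 0, 1) else (0, 1, 0))" for v
  \<comment> \<open>Different tiles separate the vertices. As \<open>E\<close>, \<open>E'\<close>
    and \<open>F\<close>, \<open>F'\<close> carry equal tiles, one vertex of each pair is treated at
    a time.\<close>
  have "distinct (map (\<lambda>t. (count t 1, count t 2, count t (-3), count t (-4), count t (-5))) (map ?t [A, B, C, D, E, F]))"
    by (simp add: t)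
  then have "distinct [A, B, C, D, E, F]"
    unfolding map_map by (simp only: distinct_map)
  moreover have "distinct (map (\<lambda>t. (count t 1, count t 2, count t (-3), count t (-4), count t (-5))) (map ?t [A, B, C, D, E', F']))"
    by (simp add: t)
  then have "distinct [A, B, C, D, E', F']"
    unfolding map_map by (simp only: distinct_map)
  moreover have "?t E \<noteq> ?t F'" "?t E' \<noteq> ?t F"
    unfolding t by (auto dest!: arg_cong[where f = "\<lambda>t. count t 3"])
  ultimately have dist: "distinct [A, B, C, D, E, E', F, F']"
    using E(2) F(2) by auto
  then have f: "f A = (0, 0, 0)" "f B = (0, 1, 1)" "f E = (1, 0, 1)" "f E' = (1, 1, 0)" "f C = (1, 1, 1)"
      "f D = (1, 0, 0)" "f F = (0, 0, 1)" "f F' = (0, 1, 0)"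
    by (auto simp: f_def)
  have "f ` verts G = UNIV"
    unfolding V UNIV_cube_vertex by (auto simp: f)
  moreover have "card (verts G) = card (UNIV :: cube_vertex set)"
    unfolding V UNIV_cube_vertex using dist by simp
  ultimately have bij_f: "bij_betw f (verts G) UNIV"
    by (simp add: bij_betw_def eq_card_imp_inj_on)
  have tail_cases: "tail G e = A \<and> col e = 1 \<or> tail G e = B \<and> col e = 2 \<or>
      (tail G e = E \<or> tail G e = E') \<and> (col e = 3 \<or> col e = 4 \<or> col e = 5)" if "e \<in> arcs G" for e
    using Vcases[OF tail_in_verts[OF that]] out_tile[OF that]
    by (elim disjE) (simp_all add: t)
  have head_cases: "head G e = C \<and> (col e = 2 \<or> col e = 3) \<or> head G e = D \<and> (col e = 1 \<or> col e = 4) \<or>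
      (head G e = F \<or> head G e = F') \<and> (col e = 1 \<or> col e = 2 \<or> col e = 5)" if "e \<in> arcs G" for e
    using Vcases[OF head_in_verts[OF that]] in_tile[OF that]
    by (elim disjE) (simp_all add: t)
  \<comment> \<open>Color 5 occurs once at \<open>E\<close> and once at \<open>F\<close>, so
    \<open>e5\<close> is its only arc at either; the other arc of color 5 must join
    \<open>E'\<close> to \<open>F'\<close>.\<close>
  have five: "col e = 5 \<longrightarrow> (tail G e = E \<longleftrightarrow> head G e = F)" if "e \<in> arcs G" for e
  proof
    assume "col e = 5"
    with that have e: "e \<in> arcs G" "col e = 5" by simp_all
    have "tail G e = E \<Longrightarrow> e = e5"
      using e e5 by (intro unique_out) (simp_all add: t)
    moreover have "head G e = F \<Longrightarrow> e = e5"
      using e e5 F(3) by (intro unique_in) (simp_all add: t)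
    ultimately show "tail G e = E \<longleftrightarrow> head G e = F" using e5(2) F(3) by blast
  qed
  \<comment> \<open>The color of an arc limits its tail and head to a few vertices; each possible
    combination is an edge that \<open>pot2_color\<close> gives this very color.\<close>
  have arc: "parity (f (tail G e)) = 0 \<and> adjacent (f (tail G e)) (f (head G e)) \<and>
      col e = pot2_color (f (tail G e)) (f (head G e))" if "e \<in> arcs G" for e
    using tail_cases[OF that] head_cases[OF that] five[OF that] E(2) F(2)
    by (elim disjE conjE) (simp_all add: f parity_def adjacent_def antipode_def pot2_color_def)
  define g where "g e = Upair (f (tail G e)) (f (head G e))" for e
  have "inj_on g (arcs G)"
  proof (rule inj_onI)
    fix e e' assume e: "e \<in> arcs G" "e' \<in> arcs G" and "g e = g e'"
    then have eq: "f (tail G e) = f (tail G e')" "f (head G e) = f (head G e')"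
      using arc[of e] arc[of e'] by (auto simp: g_def adjacent_def)
    then have th: "tail G e = tail G e'" "head G e = head G e'"
      using eq e by (simp_all add: inj_on_eq_iff[OF bij_betw_imp_inj_on[OF bij_f]])
    have "col e = col e'"
      using arc[of e] arc[of e'] e eq by simp
    \<comment> \<open>No color is repeated at both ends of an arc: repeated positive entries are
      only 1 at \<open>A\<close> and 2 at \<open>B\<close>, repeated negative ones only -3 at
      \<open>C\<close> and -4 at \<open>D\<close>. Hence equal ends and equal color determine the
      arc.\<close>
    moreover have "count (?t (tail G e)) (int (col e)) \<le> 1 \<or> count (?t (head G e)) (- int (col e)) \<le> 1"
      using tail_cases[OF e(1)] head_cases[OF e(1)]
      by (elim disjE conjE) (simp_all add: t)
    ultimately show "e = e'"
      using unique_out[of e e'] unique_in[of e e'] e th by blast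
  qed
  moreover have "g ` arcs G \<subseteq> edges cube"
    using arc by (auto simp: g_def Upair_in_edges_cube)
  \<comment> \<open>The colors 1 to 5 have 3, 3, 2, 2, 2 arcs; an injection into the 12 edges of the
    cube is then onto.\<close>
  moreover have "card (arcs G) = 12"
  proof -
    have "card {e \<in> arcs G. col e = n} = sum (\<lambda>t. card (?V t) * count t (int n)) pot2" if "n > 0" for n
      unfolding sum_count_tile_at(1)[OF col that, symmetric]
      by (rule sum_by_tile) (use pot in \<open>auto simp: induced_pot_def\<close>)
    then have n: "card {e \<in> arcs G. col e = n} = sum (\<lambda>t. card (?V t) * count t (int n)) pot2" if "n \<in> {1, 2, 3, 4, 5}" for n
      using that by auto
    have "(\<Sum>e\<in>arcs G. 1) = (\<Sum>n\<in>{1, 2, 3, 4, 5}. \<Sum>e\<in>{e \<in> arcs G. col e = n}. (1::nat))"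
      by (rule sum.group[symmetric]) (use tail_cases in auto)
    then have "card (arcs G) = (\<Sum>n\<in>{1, 2, 3, 4, 5}. card {e \<in> arcs G. col e = n})"
      by simp
    also have "\<dots> = 12"
      by (simp add: n sum_pot2 N)
    finally show ?thesis .
  qed
  ultimately have "bij_betw g (arcs G) (edges cube)"
    unfolding bij_betw_def
    by (metis card_edges_cube card_image card_subset_eq finite_edges_cube)
  with bij_f show ?thesis
    unfolding multigraph_iso_def by (intro exI[of _ f] exI[of _ g]) (simp add: g_def)
qed

theorem proposition2:
  shows "biminimal
    {{#1, 1, 1#}, {#2, 2, 2#}, {#-2, -3, -3#}, {#-1, -4, -4#}, {#3, 4, 5#}, {#-1, -2, -5#}}
    cube"
proof -
  have "H \<simeq>\<^sub>G cube" if H: "H \<in> \<O> pot2" "card (vertices H) \<le> 8" for H :: "(nat, nat) multigraph"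
  proof -
    obtain G c col where "connected_multigraph H" and G: "orientation G H" "edge_coloring G c col"
      "induced_pot G col \<subseteq> pot2"
      using H(1) by (auto simp: realized_def)
    then interpret connected_multigraph H by simp
    have verts: "verts G = vertices H" "arcs G = edges H"
      "\<And>e. e \<in> edges H \<Longrightarrow> ends H e = Upair (tail G e) (head G e)"
      using G(1) by (auto simp: orientation_def)
    have "fin_digraph G"
      using finite_vertices finite_edges ends_in_vertices verts(3) by unfold_locales (auto simp: verts(1,2))
    then have "multigraph_of G \<simeq>\<^sub>G cube"
      using G H(2) nonempty verts(1) by (intro pot2_realizes_only_cube) auto
    moreover have "H \<simeq>\<^sub>G multigraph_of G"
      unfolding multigraph_iso_def
      by (intro exI[of _ "\<lambda>x. x"] exI[of _ "\<lambda>x. x"]) (simp add: verts bij_betw_def)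
    ultimately show ?thesis
      by (rule multigraph_iso_trans[rotated])
  qed
  then have three: "three_realizes pot2 cube"
    using cube_realized_by_pot2 card_cube_vertices by (auto simp: three_realizes_def)
  \<comment> \<open>The pot attains both lower bounds, with six tiles and five colors.\<close>
  have "T\<^sub>3 cube = 6"
    unfolding T\<^sub>3_def
    by (rule Least_equality) (use three card_pot2 three_realizes_cube_lower_bounds(1) in fastforce)+
  moreover have "B\<^sub>3 cube = 5"
    unfolding B\<^sub>3_def
    by (rule Least_equality) (use three colors_pot2 three_realizes_cube_lower_bounds(2) in fastforce)+
  ultimately show ?thesis
    unfolding biminimal_def using three card_pot2 colors_pot2 by simp
qed

end
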